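(* Let $k>0$ be a constant, let $f(y,t)$ be smooth for $y\in\Omega(t)$, let $T_0:\Omega_0\to\mathbb{R}$, and let $T(y,t)$ be a smooth function defined for $t\ge0$ and $y\in\overline{\Omega(t)}$. Assume that the flux is $$\vec{J}(y,t)=-k\nabla_yT(y,t),\qquad y\in\Omega(t).$$ Then the balance problem in the moving domain $$\frac{\partial T}{\partial t}(y,t)+\operatorname{div}_y(T(y,t)\vec{V}(y))=f(y,t)-\operatorname{div}_y\vec{J},\ y\in\Omega(t);\quad T(y,t)=0,\ y\in\partial\Omega(t),\ \forall t;\quad T(y,0)=T_0(y),\ y\in\Omega_0$$ and its equivalent pulled-back form $$\frac{\partial\overline{T}}{\partial t}(x,t)+\overline{T}(x,t)\,\overline{\operatorname{div}\vec{V}}(x,t)=\overline{f}(x,t)-\overline{\operatorname{div}_y\vec{J}}(x,t),\ x\in\Omega_0;\quad \overline{T}(x,t)=0,\ x\in\partial\Omega_0,\ \forall t;\quad \overline{T}(x,0)=T_0(x),\ x\in\Omega_0$$ read, respectively, $$\frac{\partial T}{\partial t}(y,t)+\nabla_yT(y,t)\cdot\vec{V}(y)+T(y,t)\operatorname{div}\vec{V}(y)-k\Delta T(y,t)=f(y,t),\quad y\in\Omega(t),$$ with $T(y,t)=0$ for $y\in\partial\Omega(t)$ and all $t$, $T(y,0)=T_0(y)$ for $y\in\Omega_0$, and $$\frac{\partial\overline{T}}{\partial t}(x,t)+\overline{T}(x,t)\,\overline{\operatorname{div}\vec{V}}(x,t)-k\left(\sum_{l,i=1}^n a_{l,i}(x,t)\frac{\partial^2\overline{T}}{\partial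 x_l\partial x_i}(x,t)+\sum_{i=1}^n s_i(x,t)\frac{\partial\overline{T}}{\partial x_i}(x,t)\right)=\overline{f}(x,t),\quad x\in\Omega_0,$$ with $\overline{T}(x,t)=0$ for $x\in\partial\Omega_0$ and all $t$, $\overline{T}(x,0)=T_0(x)$ for $x\in\Omega_0$, where, with $y=\phi(t)x$, $$a_{l,i}(x,t)=\sum_{j=1}^n\frac{\partial\psi_l(t)y}{\partial y_j}\frac{\partial\psi_i(t)y}{\partial y_j}=\nabla_y\psi_l(t)y\cdot\nabla_y\psi_i(t)y,\qquad s_i(x,t)=\sum_{j=1}^n\frac{\partial^2\psi_i(t)y}{\partial y_j^2}=\Delta_y\psi_i(t)y.$$
   Context: $\Omega_0\subset\mathbb{R}^n$ is a smooth open set (domain). $\vec{V}:\mathbb{R}^n\to\mathbb{R}^n$ is a smooth vector field such that all solutions of the autonomous ODE $\dot Y=\vec{V}(Y)$ are defined for all $t\in\mathbb{R}$. For $t\in\mathbb{R}$, $\phi(t):\mathbb{R}^n\to\mathbb{R}^n$ is the flow map: $\phi(t)x=Y(t;x)$, where $Y(\cdot;x)$ is the solution with $Y(0;x)=x$; $\psi(t)=\phi(t)^{-1}=\phi(-t)$, with components $\psi_1(t),\dots,\psi_n(t)$. The moving domain is $\Omega(t)=\phi(t)\Omega_0$, with $\partial\Omega(t)=\phi(t)\partial\Omega_0$. For a function $g(y,t)$ defined for $y\in\Omega(t)$ (or its closure), the pulled-back function is $\overline{g}(x,t)=g(\phi(t)x,t)$; so $\overline{\operatorname{div}\vec{V}}(x,t)=(\operatorname{div}\vec{V})(\phi(t)x)$.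 *)

theory Defs
  imports "HOL-Analysis.Analysis"
begin

section \<open>Smoothness\<close>

fun Ck_on :: "nat \<Rightarrow> 'a::euclidean_space set \<Rightarrow> ('a \<Rightarrow> 'b::real_normed_vector) \<Rightarrow> bool" where
  "Ck_on 0 U f \<longleftrightarrow> continuous_on U f"
| "Ck_on (Suc k) U f \<longleftrightarrow>
     (\<forall>x\<in>U. f differentiable (at x)) \<and> (\<forall>v. Ck_on k U (\<lambda>x. frechet_derivative f (at x) v))"

text \<open>On an arbitrary set \<open>S\<close> (such as a closed one), smooth means: locally the restriction
  of a smooth function on an open set. If \<open>S\<close> is open, this is the usual notion.\<close>

definition smooth_on :: "'a::euclidean_space set \<Rightarrow> ('a \<Rightarrow> 'b::real_normed_vector) \<Rightarrow> bool" where
  "smooth_on S f \<longleftrightarrow>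
     (\<forall>p\<in>S. \<exists>U g. open U \<and> p \<in> U \<and> (\<forall>k. Ck_on k U g) \<and> (\<forall>q\<in>U \<inter> S. g q = f q))"

section \<open>Differential operators in Cartesian coordinates\<close>

definition partial :: "'n \<Rightarrow> (real^'n \<Rightarrow> real) \<Rightarrow> real^'n \<Rightarrow> real" where
  "partial i u y = deriv (\<lambda>h. u (y + h *\<^sub>R axis i 1)) 0"

definition grad :: "(real^'n \<Rightarrow> real) \<Rightarrow> real^'n \<Rightarrow> real^'n" where
  "grad u y = (\<chi> i. partial i u y)"

definition divergence :: "(real^'n \<Rightarrow> real^'n) \<Rightarrow> real^'n \<Rightarrow> real" where
  "divergence W y = (\<Sum>i\<in>UNIV. partial i (\<lambda>z. W z $ i) y)"

definition laplacian :: "(real^'n \<Rightarrow> real) \<Rightarrow> real^'n \<Rightarrow> real" where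
  "laplacian u y = (\<Sum>i\<in>UNIV. partial i (partial i u) y)"

text \<open>The unknowns are defined for \<open>t \<ge> 0\<close> only, so the time derivative at \<open>t = 0\<close> is one-sided.\<close>

definition time_deriv :: "('a \<Rightarrow> real \<Rightarrow> real) \<Rightarrow> 'a \<Rightarrow> real \<Rightarrow> real" where
  "time_deriv u y t = vector_derivative (\<lambda>s. u y s) (at t within {0..})"

section \<open>Smooth open sets, flows, moving domains\<close>

text \<open>Near each boundary point, the set is the sublevel set of a smooth function with nonvanishing
  gradient; in particular it lies locally on one side of its boundary.\<close>

definition smooth_open_set :: "(real^'n) set \<Rightarrow> bool" where
  "smooth_open_set D \<longleftrightarrow> open D \<and>
     (\<forall>p\<in>frontier D. \<exists>U g. open U \<and> p \<in> U \<and> smooth_on U g \<and>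
        (\<forall>x\<in>U. grad g x \<noteq> 0) \<and> D \<inter> U = {x \<in> U. g x < 0})"

text \<open>The curve \<open>\<lambda>t. \<phi> t x\<close> is the solution of \<open>Y' = V Y\<close>, \<open>Y 0 = x\<close>, on all of \<open>\<real>\<close>. For smooth \<open>V\<close>
  solutions are unique, so such a \<open>\<phi>\<close> exists iff all solutions are global, and it is then
  determined by \<open>V\<close>.\<close>

definition flow_of :: "(real^'n \<Rightarrow> real^'n) \<Rightarrow> (real \<Rightarrow> real^'n \<Rightarrow> real^'n) \<Rightarrow> bool" where
  "flow_of V \<phi> \<longleftrightarrow>
     (\<forall>x. \<phi> 0 x = x \<and> (\<forall>t. ((\<lambda>s. \<phi> s x) has_vector_derivative V (\<phi> t x)) (at t)))"

definition moving_domain ::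
    "(real \<Rightarrow> real^'n \<Rightarrow> real^'n) \<Rightarrow> (real^'n) set \<Rightarrow> real \<Rightarrow> (real^'n) set" where
  "moving_domain \<phi> D t = \<phi> t ` D"

definition pullback ::
    "(real \<Rightarrow> real^'n \<Rightarrow> real^'n) \<Rightarrow> (real^'n \<Rightarrow> real \<Rightarrow> 'b) \<Rightarrow> real^'n \<Rightarrow> real \<Rightarrow> 'b" where
  "pullback \<phi> g x t = g (\<phi> t x) t"

text \<open>The components of \<open>\<psi>(t) = \<phi>(t)\<^sup>-\<^sup>1\<close>.\<close>

definition psi :: "(real \<Rightarrow> real^'n \<Rightarrow> real^'n) \<Rightarrow> 'n \<Rightarrow> real \<Rightarrow> real^'n \<Rightarrow> real" where
  "psi \<phi> i t y = inv (\<phi> t) y $ i"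

definition coeff_a :: "(real \<Rightarrow> real^'n \<Rightarrow> real^'n) \<Rightarrow> 'n \<Rightarrow> 'n \<Rightarrow> real^'n \<Rightarrow> real \<Rightarrow> real" where
  "coeff_a \<phi> l i x t =
     (\<Sum>j\<in>UNIV. partial j (psi \<phi> l t) (\<phi> t x) * partial j (psi \<phi> i t) (\<phi> t x))"

definition coeff_s :: "(real \<Rightarrow> real^'n \<Rightarrow> real^'n) \<Rightarrow> 'n \<Rightarrow> real^'n \<Rightarrow> real \<Rightarrow> real" where
  "coeff_s \<phi> i x t = (\<Sum>j\<in>UNIV. partial j (partial j (psi \<phi> i t)) (\<phi> t x))"

section \<open>The equations at a point, and the initial-boundary value problem\<close>

definition balance_eq where
  "balance_eq V J f T (y::real^'n) (t::real) \<longleftrightarrow>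
     time_deriv T y t + divergence (\<lambda>z. T z t *\<^sub>R V z) y = f y t - divergence (\<lambda>z. J z t) y"

definition pulled_balance_eq where
  "pulled_balance_eq \<phi> V J f T (x::real^'n) (t::real) \<longleftrightarrow>
     time_deriv (pullback \<phi> T) x t + pullback \<phi> T x t * pullback \<phi> (\<lambda>y t. divergence V y) x t
       = pullback \<phi> f x t - pullback \<phi> (\<lambda>y t. divergence (\<lambda>z. J z t) y) x t"

definition heat_eq where
  "heat_eq k V f T (y::real^'n) (t::real) \<longleftrightarrow>
     time_deriv T y t + grad (\<lambda>z. T z t) y \<bullet> V y + T y t * divergence V y
       - k * laplacian (\<lambda>z. T z t) y = f y t"

definition pulled_heat_eq where
  "pulled_heat_eq k \<phi> V f T (x::real^'n) (t::real) \<longleftrightarrow>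
     time_deriv (pullback \<phi> T) x t + pullback \<phi> T x t * pullback \<phi> (\<lambda>y t. divergence V y) x t
       - k * ((\<Sum>l\<in>UNIV. \<Sum>i\<in>UNIV.
                 coeff_a \<phi> l i x t * partial l (partial i (\<lambda>z. pullback \<phi> T z t)) x)
              + (\<Sum>i\<in>UNIV. coeff_s \<phi> i x t * partial i (\<lambda>z. pullback \<phi> T z t) x))
       = pullback \<phi> f x t"

text \<open>The domain at time \<open>t\<close> is \<open>D t\<close>; at the initial time it is \<open>D\<^sub>0\<close>.\<close>

definition ibvp where
  "ibvp D D\<^sub>0 eqn (u :: real^'n \<Rightarrow> real \<Rightarrow> real) u\<^sub>0 \<longleftrightarrow>
     (\<forall>t\<ge>0. \<forall>y\<in>D t. eqn y t) \<and>
     (\<forall>t\<ge>0. \<forall>y\<in>frontier (D t). u y t = 0) \<and>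
     (\<forall>y\<in>D\<^sub>0. u y 0 = u\<^sub>0 y)"

end

theory Submission
  imports Defs
begin

text \<open>
  For fixed \<open>t\<close>, \<open>T(y, t) = T'(\<psi>(t) y, t)\<close> with \<open>T'\<close> the pulled-back function, so the chain rule
  turns \<open>\<Delta> T\<close> into the second-order operator with coefficients \<open>a\<close> and \<open>s\<close>; along a trajectory
  the chain rule produces the transport term \<open>\<nabla> T \<bullet> V\<close>. What has to be shown is that \<open>\<phi>(t)\<close> and its
  inverse \<open>\<phi>(-t)\<close> are twice differentiable. Gronwall's inequality gives local Lipschitz dependence on
  the initial point and shows that difference quotients of the flow converge to solutions of the
  variational equation, which therefore is the equation of the derivative of the flow.
\<close>

section \<open>Dependence of a flow on the initial point\<close>

text \<open>\<open>flow_of\<close> records only the differential equation in time, so how \<phi>(t)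
  depends on x has to be derived from it. The obstacle is the second derivative: the first-order
  theorem asks for a C1 field and yields one derivative only. Instead of a second Gronwall argument,
  the flow is paired with its derivative acting on a vector v. This pair is again a flow, of the
  field (F(x), DF(x) v) on the product space, and that field is C1 when F is C2. The first-order
  theorem for it contains the second derivative of the original flow. T is given only for t \<ge> 0,
  so at t = 0 it is not defined on a space-time neighbourhood. Local smooth extensions g repair
  this: a single derivative of g at (y, t) yields the time derivative at fixed y, the gradient, and
  the derivative along the trajectory, and linearity relates the three. The chain rule is used twice
  on T' composed with \<psi>(t): a collects the products of first derivatives of \<psi>, s its
  second derivatives.\<close>

text \<open>The squared norm is used because the norm itself need not be differentiable at \<open>0\<close>.\<close>

lemma gronwall_sq:
  fixes u :: "real \<Rightarrow> 'a::real_inner"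
  assumes der: "\<And>s. (u has_vector_derivative u' s) (at s)"
    and bd: "\<And>s. \<bar>s\<bar> < t \<Longrightarrow> norm (u' s) \<le> L * norm (u s) + e"
    and r: "\<bar>r\<bar> \<le> t" and L: "0 \<le> L" and e: "0 \<le> e"
  shows "(norm (u r))\<^sup>2 \<le> ((norm (u 0))\<^sup>2 + e\<^sup>2 * t) * exp ((2 * L + 1) * t)"
proof -
  have forward: "(norm (v r))\<^sup>2 \<le> ((norm (v 0))\<^sup>2 + e\<^sup>2 * t) * exp ((2 * L + 1) * t)"
    if der: "\<And>s. (v has_vector_derivative v' s) (at s)"
      and bd: "\<And>s. \<bar>s\<bar> < t \<Longrightarrow> norm (v' s) \<le> L * norm (v s) + e"
      and r: "0 \<le> r" "r \<le> t" for v v' :: "real \<Rightarrow> 'a" and r :: real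
  proof -
    \<comment> \<open>\<open>2 * L\<close> absorbs the Lipschitz part of twice the inner product of
      v and v', and the extra 1 comes from 2 e |v| \<le> |v|^2 + e^2. The remaining e^2 is cancelled
      by the linear term in \<open>q\<close>, which makes \<open>q\<close> nonincreasing.\<close>
    define C where "C = 2 * L + 1"
    define q where "q s = (v s \<bullet> v s) * exp (- C * s) - e\<^sup>2 * s" for s
    have q': "(q has_real_derivative
        (2 * (v s \<bullet> v' s) - C * (v s \<bullet> v s)) * exp (- C * s) - e\<^sup>2) (at s)" for s
    proof -
      have "((\<lambda>s. v s \<bullet> v s) has_derivative (\<lambda>h. h * (2 * (v s \<bullet> v' s)))) (at s)"
        using der[of s] unfolding has_vector_derivative_def
        by (auto intro!: derivative_eq_intros simp: inner_commute algebra_simps)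
      then have "((\<lambda>s. v s \<bullet> v s) has_real_derivative 2 * (v s \<bullet> v' s)) (at s)"
        by (simp add: has_field_derivative_def mult.commute[of _ "2 * (v s \<bullet> v' s)"])
      then show ?thesis
        unfolding q_def by (auto intro!: derivative_eq_intros simp: algebra_simps)
    qed
    have q'_le: "(2 * (v s \<bullet> v' s) - C * (v s \<bullet> v s)) * exp (- C * s) - e\<^sup>2 \<le> 0"
      if s: "0 < s" "s < r" for s
    proof -
      have "2 * (v s \<bullet> v' s) \<le> 2 * (norm (v s) * norm (v' s))"
        using norm_cauchy_schwarz[of "v s" "v' s"] by simp
      also have "\<dots> \<le> 2 * (norm (v s) * (L * norm (v s) + e))"
        using bd[of s] s r by (intro mult_left_mono) auto
      also have "\<dots> \<le> C * (v s \<bullet> v s) + e\<^sup>2"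
        using zero_le_power2[of "norm (v s) - e"]
        by (simp add: C_def dot_square_norm power2_eq_square algebra_simps)
      finally have "(2 * (v s \<bullet> v' s) - C * (v s \<bullet> v s)) * exp (- C * s) \<le> e\<^sup>2 * exp (- C * s)"
        by (intro mult_right_mono) auto
      also have "\<dots> \<le> e\<^sup>2 * 1"
        using s L by (intro mult_left_mono) (auto simp: C_def mult_le_0_iff)
      finally show ?thesis by simp
    qed
    have "q r \<le> q 0"
    proof (cases "r = 0")
      case False
      \<comment> \<open>The sign of the derivative is used in the open interval only, because
        \<open>bd\<close> says nothing at the endpoints. The first-exit argument of
        \<open>solution_dependence\<close> relies on this.\<close>
      show ?thesis
      proof (rule DERIV_nonpos_imp_decreasing_open[where f = q])
        show "continuous_on {0..r} q"
          by (intro continuous_at_imp_continuous_on ballI) (use q' DERIV_isCont in blast)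
      qed (use r q' q'_le in \<open>auto intro!: exI\<close>)
    qed simp
    then have "(v r \<bullet> v r) * exp (- C * r) \<le> v 0 \<bullet> v 0 + e\<^sup>2 * r"
      by (simp add: q_def)
    then have "(v r \<bullet> v r) * exp (- C * r) * exp (C * r) \<le> (v 0 \<bullet> v 0 + e\<^sup>2 * r) * exp (C * r)"
      by (intro mult_right_mono) auto
    also have "\<dots> \<le> (v 0 \<bullet> v 0 + e\<^sup>2 * t) * exp (C * t)"
      using r L by (intro mult_mono add_left_mono mult_left_mono) (auto simp: C_def)
    also have "(v r \<bullet> v r) * exp (- C * r) * exp (C * r) = v r \<bullet> v r"
      by (simp add: mult.assoc flip: exp_add)
    finally show ?thesis
      by (simp add: C_def dot_square_norm)
  qed
  show ?thesis
  proof (cases "0 \<le> r")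
    case True
    then show ?thesis using forward[OF der bd] r by simp
  next
    case False
    \<comment> \<open>Negative times reduce to positive ones by reversing time; the hypothesis is
      symmetric in s.\<close>
    have "((\<lambda>s. u (- s)) has_vector_derivative - u' (- s)) (at s)" for s
    proof -
      have "((u \<circ> uminus) has_vector_derivative (-1) *\<^sub>R u' (- s)) (at s)"
        by (rule vector_diff_chain_at) (auto intro!: derivative_eq_intros der)
      then show ?thesis by (simp add: o_def)
    qed
    from forward[OF this, of "- r"] show ?thesis
      using False r bd by simp
  qed
qed

lemma bounded_on_interval:
  fixes u :: "real \<Rightarrow> 'b::real_normed_vector"
  assumes "\<And>s. (u has_vector_derivative u' s) (at s)"
  obtains R where "\<And>s. \<bar>s\<bar> \<le> t \<Longrightarrow> norm (u s) \<le> R"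
proof -
  have "compact (u ` {-t..t})"
    by (intro compact_continuous_image continuous_at_imp_continuous_on ballI compact_Icc
        has_vector_derivative_continuous[OF assms])
  then obtain R where "\<And>s. s \<in> {-t..t} \<Longrightarrow> norm (u s) \<le> R"
    using compact_imp_bounded[THEN bounded_pos[THEN iffD1]] by (metis imageI)
  then show thesis by (intro that[of R]) (auto simp: abs_le_iff)
qed

text \<open>The derivative is a bounded linear map, so that \<open>cont\<close> is continuity in the
  operator norm and compactness yields bounds uniform in the direction.\<close>

locale C1_flow =
  fixes F :: "'a::euclidean_space \<Rightarrow> 'a" and F' :: "'a \<Rightarrow> 'a \<Rightarrow>\<^sub>L 'a" and \<phi> :: "real \<Rightarrow> 'a \<Rightarrow> 'a"
  assumes deriv: "(F has_derivative F' x) (at x)"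
    and cont: "continuous_on UNIV F'"
    and init: "\<phi> 0 x = x"
    and flow: "((\<lambda>s. \<phi> s x) has_vector_derivative F (\<phi> t x)) (at t)"
begin

lemma lipschitz_on_cball:
  obtains L where "0 \<le> L" "\<And>a. norm a \<le> R \<Longrightarrow> norm (F' a) \<le> L"
    "\<And>a b. norm a \<le> R \<Longrightarrow> norm b \<le> R \<Longrightarrow> norm (F b - F a) \<le> L * norm (b - a)"
proof -
  have "compact (F' ` cball 0 R)"
    by (intro compact_continuous_image continuous_on_subset[OF cont]) auto
  then have "bounded (F' ` cball 0 R)" by (rule compact_imp_bounded)
  then obtain L where L: "0 < L" "\<And>a. norm a \<le> R \<Longrightarrow> norm (F' a) \<le> L"
    unfolding bounded_pos by auto
  have "norm (F b - F a) \<le> L * norm (b - a)" if "norm a \<le> R" "norm b \<le> R" for a b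
  proof (rule differentiable_bound[OF convex_cball[of 0 R]])
    show "(F has_derivative F' x) (at x within cball 0 R)" for x
      using deriv by (rule has_derivative_at_withinI)
    show "onorm (blinfun_apply (F' x)) \<le> L" if "x \<in> cball 0 R" for x
      using L(2)[of x] that by (simp add: norm_blinfun.rep_eq)
  qed (use that in auto)
  with L show thesis by (intro that[of L]) auto
qed

text \<open>The mean value inequality bounds the remainder by the oscillation of F' between a and b.
  Uniform continuity of F' on a compact ball makes this small with one d for all base points
  a.\<close>

lemma uniform_linearization:
  assumes e: "0 < e"
  obtains d where "0 < d"
    "\<And>a b. norm a \<le> R \<Longrightarrow> norm (b - a) < d \<Longrightarrow> norm (F b - F a - F' a (b - a)) \<le> e * norm (b - a)"
proof -
  \<comment> \<open>The margin 1 keeps the points near a, which may leave the ball of radius R,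
    inside the compact set.\<close>
  have "uniformly_continuous_on (cball 0 (R + 1)) F'"
    by (intro compact_uniformly_continuous continuous_on_subset[OF cont]) auto
  then obtain d where d: "0 < d" "\<And>a b. norm a \<le> R + 1 \<Longrightarrow> norm b \<le> R + 1 \<Longrightarrow>
      dist b a < d \<Longrightarrow> dist (F' b) (F' a) < e"
    using e unfolding uniformly_continuous_on_def by (metis mem_cball_0)
  have "norm (F b - F a - F' a (b - a)) \<le> e * norm (b - a)"
    if a: "norm a \<le> R" and b: "norm (b - a) < min d 1" for a b
  proof -
    have "norm (F b - F a - F' a (b - a)) \<le> norm (b - a) * e"
    proof (rule differentiable_bound_linearization
        [where S = "ball a (min d 1)" and f' = "\<lambda>x. blinfun_apply (F' x)"])
      show "a + t *\<^sub>R (b - a) \<in> ball a (min d 1)" if "t \<in> {0..1}" for t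
      proof -
        have "t * norm (b - a) \<le> norm (b - a)"
          using that mult_right_mono[of t 1 "norm (b - a)"] by auto
        then show ?thesis using b that by (simp add: dist_norm)
      qed
      show "(F has_derivative F' x) (at x within ball a (min d 1))" for x
        using deriv by (rule has_derivative_at_withinI)
      show "onorm (blinfun_apply (F' x) - blinfun_apply (F' a)) \<le> e" if x: "x \<in> ball a (min d 1)" for x
      proof -
        have "norm x \<le> R + 1"
          using x a norm_triangle_ineq[of "x - a" a] by (simp add: dist_norm norm_minus_commute)
        then have "norm (F' x - F' a) < e"
          using d(2)[of a x] x a by (simp add: dist_norm norm_minus_commute)
        moreover have "blinfun_apply (F' x - F' a) = blinfun_apply (F' x) - blinfun_apply (F' a)"
          by (rule ext) (simp add: minus_blinfun.rep_eq)
        ultimately show ?thesis by (simp add: norm_blinfun.rep_eq)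
      qed
    qed (use d in auto)
    then show ?thesis by (simp add: mult.commute)
  qed
  with d(1) show thesis by (intro that[of "min d 1"]) auto
qed

definition solution :: "(real \<Rightarrow> 'a) \<Rightarrow> bool" where
  "solution u \<longleftrightarrow> (\<forall>s. (u has_vector_derivative F (u s)) (at s))"

lemma solution_flow: "solution (\<lambda>s. \<phi> s x)"
  by (simp add: solution_def flow)

text \<open>F is Lipschitz on bounded sets only, and v is not known in advance to stay near u. A
  first-exit argument closes the circle: as long as v stays within distance 1 of u, Gronwall gives a
  bound that is strictly below 1.\<close>

lemma solution_dependence:
  assumes u: "solution u"
  obtains d K where "0 < d" "0 \<le> K" "\<And>v s. solution v \<Longrightarrow> norm (v 0 - u 0) < d \<Longrightarrow> \<bar>s\<bar> \<le> t \<Longrightarrow>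
    norm (v s - u s) \<le> K * norm (v 0 - u 0)"
proof -
  obtain R where R: "\<And>s. \<bar>s\<bar> \<le> t \<Longrightarrow> norm (u s) \<le> R"
    using bounded_on_interval[of u "\<lambda>s. F (u s)" t] u unfolding solution_def by blast
  obtain L where L: "0 \<le> L" "\<And>a b. norm a \<le> R + 1 \<Longrightarrow> norm b \<le> R + 1 \<Longrightarrow> norm (F b - F a) \<le> L * norm (b - a)"
    using lipschitz_on_cball[of "R + 1"] by metis
  \<comment> \<open>The root undoes the square in \<open>gronwall_sq\<close>. The constant depends
    on u and t but not on v.\<close>
  define K where "K = sqrt (exp ((2 * L + 1) * \<bar>t\<bar>))"
  have K: "K > 0" by (simp add: K_def)
  show thesis
  \<comment> \<open>An initial distance below \<open>1 / K\<close> keeps the Gronwall bound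
    \<open>K * norm (v 0 - u 0)\<close> below the width 1 of the tube.\<close>
  proof (rule that[of "1 / K" K])
    fix v s assume v: "solution v" and small: "norm (v 0 - u 0) < 1 / K" and s: "\<bar>s\<bar> \<le> t"
    have der: "((\<lambda>s. v s - u s) has_vector_derivative F (v s) - F (u s)) (at s)" for s
      using u v by (auto intro!: derivative_intros simp: solution_def)
    have in_tube: "norm (v r - u r) \<le> K * norm (v 0 - u 0)"
      if tube: "\<And>s. \<bar>s\<bar> < t' \<Longrightarrow> norm (v s - u s) \<le> 1" and t': "\<bar>r\<bar> \<le> t'" "t' \<le> t" for r t'
    proof -
      have "norm (F (v s) - F (u s)) \<le> L * norm (v s - u s) + 0" if "\<bar>s\<bar> < t'" for s
      proof -
        have "norm (v s) \<le> R + 1" "norm (u s) \<le> R + 1"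
          using tube[OF that] R[of s] that t' norm_triangle_ineq[of "v s - u s" "u s"] by auto
        then show ?thesis using L by simp
      qed
      from gronwall_sq[OF der this t'(1) L(1)]
      have "(norm (v r - u r))\<^sup>2 \<le> (norm (v 0 - u 0))\<^sup>2 * exp ((2 * L + 1) * t')"
        by simp
      also have "\<dots> \<le> (norm (v 0 - u 0))\<^sup>2 * K\<^sup>2"
      proof (rule mult_left_mono)
        have "(2 * L + 1) * t' \<le> (2 * L + 1) * \<bar>t\<bar>"
          using t' L by (intro mult_left_mono) auto
        then show "exp ((2 * L + 1) * t') \<le> K\<^sup>2"
          by (simp add: K_def)
      qed simp
      also have "\<dots> = (K * norm (v 0 - u 0))\<^sup>2"
        by (simp only: power_mult_distrib mult.commute)
      finally show ?thesis
        by (rule power2_le_imp_le) (use K in simp)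
    qed
    have below: "K * norm (v 0 - u 0) < 1"
      using small K by (simp add: field_simps)
    \<comment> \<open>The times at which v has reached the wall of the tube. If there were any, a
      time \<open>s0\<close> closest to 0 would exist by compactness; the tube condition holds
      before it, so the strict bound \<open>below\<close> contradicts \<open>s0\<close> being in
      \<open>S\<close>.\<close>
    define S where "S = {s \<in> {-t..t}. 1 \<le> norm (v s - u s)}"
    have "S = {}"
    proof (rule ccontr)
      assume "S \<noteq> {}"
      moreover have "compact S"
      proof -
        have "continuous_on {-t..t} (\<lambda>s. norm (v s - u s))"
          by (intro continuous_at_imp_continuous_on ballI continuous_norm
              has_vector_derivative_continuous[OF der])
        then have "closed ({-t..t} \<inter> (\<lambda>s. norm (v s - u s)) -` {1..})"
          by (rule continuous_closed_preimage) auto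
        moreover have "S = {-t..t} \<inter> (\<lambda>s. norm (v s - u s)) -` {1..}"
          by (auto simp: S_def)
        ultimately show ?thesis
          using bounded_subset[OF bounded_closed_interval[of "-t" t], of S]
          by (auto simp: compact_eq_bounded_closed)
      qed
      ultimately obtain s0 where s0: "s0 \<in> S" "\<And>s. s \<in> S \<Longrightarrow> \<bar>s0\<bar> \<le> \<bar>s\<bar>"
        using continuous_attains_inf[of S abs] continuous_on_rabs[OF continuous_on_id] by blast
      have "norm (v s0 - u s0) \<le> K * norm (v 0 - u 0)"
      proof (rule in_tube[where t' = "\<bar>s0\<bar>"])
        show "norm (v s - u s) \<le> 1" if "\<bar>s\<bar> < \<bar>s0\<bar>" for s
        proof -
          have "s \<notin> S" using s0(2) that by fastforce
          then show ?thesis using that s0(1) by (auto simp: S_def)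
        qed
        show "\<bar>s0\<bar> \<le> t" using s0(1) by (simp add: S_def abs_le_iff)
      qed simp
      then show False using below s0(1) by (simp add: S_def)
    qed
    then show "norm (v s - u s) \<le> K * norm (v 0 - u 0)"
    proof (intro in_tube[where t' = t])
      fix r assume "S = {}" "\<bar>r\<bar> < t"
      then have "r \<notin> S" "r \<in> {-t..t}" by auto
      then show "norm (v r - u r) \<le> 1" by (simp add: S_def)
    qed (use s in auto)
  qed (use K in auto)
qed

lemma solution_unique:
  assumes "solution u" "solution v" "u 0 = v 0"
  shows "u = v"
proof
  fix t
  obtain d K where "0 < d" "\<And>v s. solution v \<Longrightarrow> norm (v 0 - u 0) < d \<Longrightarrow> \<bar>s\<bar> \<le> \<bar>t\<bar> \<Longrightarrow>
    norm (v s - u s) \<le> K * norm (v 0 - u 0)"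
    using solution_dependence[OF assms(1), of "\<bar>t\<bar>"] by metis
  from this(1) this(2)[OF assms(2), of t] show "u t = v t"
    using assms(3) by simp
qed

text \<open>The equation is autonomous, so a time shift of a solution is a solution, and uniqueness
  applies.\<close>

lemma flow_add: "\<phi> s (\<phi> t x) = \<phi> (s + t) x"
proof -
  have "solution (\<lambda>s. \<phi> (s + t) x)"
    unfolding solution_def
  proof
    fix s
    have "((\<lambda>s. \<phi> s x) \<circ> (\<lambda>s. s + t) has_vector_derivative 1 *\<^sub>R F (\<phi> (s + t) x)) (at s)"
      by (rule vector_diff_chain_at) (auto intro!: derivative_eq_intros flow)
    then show "((\<lambda>s. \<phi> (s + t) x) has_vector_derivative F (\<phi> (s + t) x)) (at s)"
      by (simp add: o_def)
  qed
  from solution_unique[OF solution_flow this] show ?thesis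
    by (metis add_0 init)
qed

lemma flow_inverse: "\<phi> (- t) (\<phi> t x) = x" "\<phi> t (\<phi> (- t) x) = x"
  by (simp_all add: flow_add init)

lemma inv_flow: "inv (\<phi> t) = \<phi> (- t)"
  by (rule inv_unique_comp) (auto simp: flow_inverse)

lemma flow_dependence:
  obtains d K where "0 < d" "0 \<le> K"
    "\<And>y s. norm (y - x) < d \<Longrightarrow> \<bar>s\<bar> \<le> t \<Longrightarrow> norm (\<phi> s y - \<phi> s x) \<le> K * norm (y - x)"
proof -
  obtain d K where "0 < d" "0 \<le> K" and *: "\<And>v s. solution v \<Longrightarrow> norm (v 0 - x) < d \<Longrightarrow> \<bar>s\<bar> \<le> t \<Longrightarrow>
    norm (v s - \<phi> s x) \<le> K * norm (v 0 - x)"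
    using solution_dependence[OF solution_flow, of x t] unfolding init by metis
  then show thesis
    using *[OF solution_flow] unfolding init by (intro that)
qed

end

section \<open>Differentiability of the flow\<close>

context C1_flow
begin

text \<open>The linearized equation along the trajectory of x, as found by formally differentiating
  the flow equation in the initial point.\<close>

definition variational :: "'a \<Rightarrow> (real \<Rightarrow> 'a) \<Rightarrow> bool" where
  "variational x w \<longleftrightarrow> (\<forall>s. (w has_vector_derivative F' (\<phi> s x) (w s)) (at s))"

lemma flow_bounded:
  obtains R where "\<And>s. \<bar>s\<bar> \<le> t \<Longrightarrow> norm (\<phi> s x) \<le> R"
  using bounded_on_interval[of "\<lambda>s. \<phi> s x", OF flow, of t] by metis

lemma derivative_bounded_along_flow:
  obtains L where "0 \<le> L" "\<And>s v. \<bar>s\<bar> \<le> t \<Longrightarrow> norm (F' (\<phi> s x) v) \<le> L * norm v"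
proof -
  obtain R where R: "\<And>s. \<bar>s\<bar> \<le> t \<Longrightarrow> norm (\<phi> s x) \<le> R"
    using flow_bounded[of t x] by metis
  obtain L where L: "0 \<le> L" "\<And>a. norm a \<le> R \<Longrightarrow> norm (F' a) \<le> L"
    using lipschitz_on_cball[of R] by metis
  have "norm (F' (\<phi> s x) v) \<le> L * norm v" if "\<bar>s\<bar> \<le> t" for s v
    using norm_blinfun[of "F' (\<phi> s x)" v] L(2)[OF R[OF that]]
      mult_right_mono[of "norm (F' (\<phi> s x))" L "norm v"] by simp
  with L show thesis by (intro that[of L]) auto
qed

text \<open>Lipschitz dependence on the initial point turns an error relative to the distance at
  time s into one relative to the distance at time 0.\<close>

lemma flow_linearization:
  assumes e: "0 < e"
  obtains d where "0 < d" "\<And>y s. norm (y - x) < d \<Longrightarrow> \<bar>s\<bar> \<le> t \<Longrightarrow>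
    norm (F (\<phi> s y) - F (\<phi> s x) - F' (\<phi> s x) (\<phi> s y - \<phi> s x)) \<le> e * norm (y - x)"
proof -
  obtain d K where d: "0 < d" "0 \<le> K" and
    dep: "\<And>y s. norm (y - x) < d \<Longrightarrow> \<bar>s\<bar> \<le> t \<Longrightarrow> norm (\<phi> s y - \<phi> s x) \<le> K * norm (y - x)"
    using flow_dependence[of x t] by metis
  obtain R where R: "\<And>s. \<bar>s\<bar> \<le> t \<Longrightarrow> norm (\<phi> s x) \<le> R"
    using flow_bounded[of t x] by metis
  \<comment> \<open>K may be 0, so the division is by \<open>K + 1\<close>.\<close>
  define e' where "e' = e / (K + 1)"
  have e': "0 < e'" "e' * K \<le> e"
    using e d by (auto simp: e'_def field_simps)
  obtain d' where d': "0 < d'" and lin: "\<And>a b. norm a \<le> R \<Longrightarrow> norm (b - a) < d' \<Longrightarrow>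
      norm (F b - F a - F' a (b - a)) \<le> e' * norm (b - a)"
    using uniform_linearization[OF e'(1), of R] by metis
  show thesis
  proof (rule that[of "min d (d' / (K + 1))"])
    fix y s assume y: "norm (y - x) < min d (d' / (K + 1))" and s: "\<bar>s\<bar> \<le> t"
    have near: "norm (\<phi> s y - \<phi> s x) \<le> K * norm (y - x)"
      using dep y s by simp
    also have "\<dots> \<le> (K + 1) * norm (y - x)"
      by (intro mult_right_mono) auto
    also have "\<dots> < d'"
      using y d by (simp add: field_simps)
    finally have "norm (F (\<phi> s y) - F (\<phi> s x) - F' (\<phi> s x) (\<phi> s y - \<phi> s x))
        \<le> e' * norm (\<phi> s y - \<phi> s x)"
      by (intro lin R s)
    also have "\<dots> \<le> e' * (K * norm (y - x))"
      using near e' by (intro mult_left_mono) auto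
    also have "\<dots> = (e' * K) * norm (y - x)" by simp
    also have "\<dots> \<le> e * norm (y - x)"
      using e' by (intro mult_right_mono) auto
    finally show "norm (F (\<phi> s y) - F (\<phi> s x) - F' (\<phi> s x) (\<phi> s y - \<phi> s x)) \<le> e * norm (y - x)" .
  qed (use d d' in auto)
qed

text \<open>An approximate solution of the variational equation that starts at 0 is bounded by its
  residual. What matters is the order of quantifiers: \<open>C\<close> depends on t and x only and
  is fixed before the approximate solution and its residual.\<close>

lemma gronwall_linear:
  obtains C where "0 < C" "\<And>u u' e s. (\<And>s. (u has_vector_derivative u' s) (at s)) \<Longrightarrow> u 0 = 0 \<Longrightarrow> 0 \<le> e \<Longrightarrow>
    (\<And>s. \<bar>s\<bar> \<le> t \<Longrightarrow> norm (u' s - F' (\<phi> s x) (u s)) \<le> e) \<Longrightarrow> \<bar>s\<bar> \<le> t \<Longrightarrow> norm (u s) \<le> C * e"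
proof -
  obtain L where L: "0 \<le> L" "\<And>s v. \<bar>s\<bar> \<le> t \<Longrightarrow> norm (F' (\<phi> s x) v) \<le> L * norm v"
    using derivative_bounded_along_flow[of t x] by metis
  \<comment> \<open>The summand 1 makes \<open>C\<close> positive, so that later choices of a
    tolerance can divide by it.\<close>
  define C where "C = sqrt (\<bar>t\<bar> * exp ((2 * L + 1) * t)) + 1"
  have C: "1 \<le> C" by (simp add: C_def)
  show thesis
  proof (rule that[of C])
    fix u u' :: "real \<Rightarrow> 'a" and e s :: real
    assume u: "\<And>s. (u has_vector_derivative u' s) (at s)" "u 0 = 0" and e: "0 \<le> e"
      and u': "\<And>s. \<bar>s\<bar> \<le> t \<Longrightarrow> norm (u' s - F' (\<phi> s x) (u s)) \<le> e" and s: "\<bar>s\<bar> \<le> t"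
    have "norm (u' r) \<le> L * norm (u r) + e" if "\<bar>r\<bar> < t" for r
      using u'[of r] L(2)[of r "u r"] that norm_triangle_sub[of "u' r" "F' (\<phi> r x) (u r)"] by simp
    from gronwall_sq[OF u(1) this s L(1) e]
    have "(norm (u s))\<^sup>2 \<le> e\<^sup>2 * (\<bar>t\<bar> * exp ((2 * L + 1) * t))"
      using s u(2) by (simp add: mult.assoc)
    also have "\<dots> \<le> e\<^sup>2 * C\<^sup>2"
    proof (rule mult_left_mono)
      have "\<bar>t\<bar> * exp ((2 * L + 1) * t) = (sqrt (\<bar>t\<bar> * exp ((2 * L + 1) * t)))\<^sup>2"
        by simp
      also have "\<dots> \<le> C\<^sup>2"
        unfolding C_def by (intro power_mono) auto
      finally show "\<bar>t\<bar> * exp ((2 * L + 1) * t) \<le> C\<^sup>2" .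
    qed simp
    also have "\<dots> = (C * e)\<^sup>2" by (simp only: power_mult_distrib mult.commute)
    finally show "norm (u s) \<le> C * e"
      by (rule power2_le_imp_le) (use C e in simp)
  qed (use C in auto)
qed

lemma variational_diff:
  assumes "variational x w" "variational x w'"
  shows "variational x (\<lambda>s. w s - w' s)"
  using assms unfolding variational_def
  by (auto intro!: derivative_eq_intros simp: blinfun.diff_right)

text \<open>By linearity the difference solves the same equation from initial value 0, and Gronwall
  applies with residual 0.\<close>

lemma variational_unique:
  assumes "variational x w" "variational x w'" "w 0 = w' 0"
  shows "w = w'"
proof
  fix t
  obtain C where "0 < C" and gron: "\<And>u u' e s. (\<And>s. (u has_vector_derivative u' s) (at s)) \<Longrightarrow> u 0 = 0 \<Longrightarrow> 0 \<le> e \<Longrightarrow>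
    (\<And>s. \<bar>s\<bar> \<le> \<bar>t\<bar> \<Longrightarrow> norm (u' s - F' (\<phi> s x) (u s)) \<le> e) \<Longrightarrow> \<bar>s\<bar> \<le> \<bar>t\<bar> \<Longrightarrow> norm (u s) \<le> C * e"
    using gronwall_linear[where t = "\<bar>t\<bar>" and x = x] by blast
  from gron[of "\<lambda>s. w s - w' s" "\<lambda>s. F' (\<phi> s x) (w s - w' s)" 0 t]
  have "norm (w t - w' t) \<le> C * 0"
    using variational_diff[OF assms(1,2)] assms(3) by (simp add: variational_def)
  then show "w t = w' t" by simp
qed

text \<open>The difference quotients of the flow are uniformly Cauchy by Gronwall's inequality, so
  their limit solves the variational equation and no existence theorem for linear differential
  equations is needed.\<close>

lemma variational_exists:
  obtains w where "variational x w" "w 0 = v"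
proof -
  define y where "y n = x + inverse (real (Suc n)) *\<^sub>R v" for n
  define q where "q n s = real (Suc n) *\<^sub>R (\<phi> s (y n) - \<phi> s x)" for n s
  define q' where "q' n s = real (Suc n) *\<^sub>R (F (\<phi> s (y n)) - F (\<phi> s x))" for n s
  have q: "(q n has_vector_derivative q' n s) (at s)" for n s
    unfolding q_def q'_def
    by (intro bounded_linear.has_vector_derivative[OF bounded_linear_scaleR_right]
        has_vector_derivative_diff flow)
  have q0: "q n 0 = v" for n
    by (simp add: q_def init y_def)
  have y: "norm (y n - x) = inverse (real (Suc n)) * norm v" for n
    by (simp add: y_def)
  have y_lim: "(\<lambda>n. norm (y n - x)) \<longlonglongrightarrow> 0"
    unfolding y using tendsto_mult_left_zero[OF LIMSEQ_inverse_real_of_nat] by blast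
  have approx: "\<forall>\<^sub>F n in sequentially. \<forall>s. \<bar>s\<bar> \<le> t \<longrightarrow> norm (q' n s - F' (\<phi> s x) (q n s)) \<le> e"
    if e: "0 < e" for t e
  proof -
    \<comment> \<open>The factor \<open>Suc n\<close> of the quotient cancels the distance from
      \<open>y n\<close> to x up to \<open>norm v\<close>, so the residual is at most
      \<open>e' * norm v\<close>.\<close>
    define e' where "e' = e / (norm v + 1)"
    have e': "0 < e'" "e' * norm v \<le> e"
      using e by (auto simp: e'_def field_simps add_pos_nonneg)
    obtain d where d: "0 < d" and lin: "\<And>y s. norm (y - x) < d \<Longrightarrow> \<bar>s\<bar> \<le> t \<Longrightarrow>
      norm (F (\<phi> s y) - F (\<phi> s x) - F' (\<phi> s x) (\<phi> s y - \<phi> s x)) \<le> e' * norm (y - x)"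
      using flow_linearization[OF e'(1), of x t] by metis
    have "\<forall>\<^sub>F n in sequentially. norm (y n - x) < d"
      using y_lim d by (rule order_tendstoD)
    then show ?thesis
    proof (eventually_elim, intro allI impI)
      fix n s assume n: "norm (y n - x) < d" and s: "\<bar>s\<bar> \<le> t"
      have "q' n s - F' (\<phi> s x) (q n s) =
          real (Suc n) *\<^sub>R (F (\<phi> s (y n)) - F (\<phi> s x) - F' (\<phi> s x) (\<phi> s (y n) - \<phi> s x))"
        unfolding q_def q'_def by (simp only: scaleR_diff_right blinfun.scaleR_right blinfun.diff_right)
      then have "norm (q' n s - F' (\<phi> s x) (q n s)) =
          real (Suc n) * norm (F (\<phi> s (y n)) - F (\<phi> s x) - F' (\<phi> s x) (\<phi> s (y n) - \<phi> s x))"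
        by (simp only: norm_scaleR abs_of_nat)
      also have "\<dots> \<le> real (Suc n) * (e' * norm (y n - x))"
        by (intro mult_left_mono lin n s) auto
      also have "\<dots> = e' * norm v"
        unfolding y by (simp add: field_simps)
      finally show "norm (q' n s - F' (\<phi> s x) (q n s)) \<le> e" using e' by simp
    qed
  qed
  define w where "w s = lim (\<lambda>n. q n s)" for s
  have unif: "uniform_limit {-t..t} q w sequentially" for t
  proof -
    have "uniformly_Cauchy_on {-t..t} q"
    proof (rule uniformly_Cauchy_onI)
      fix e :: real assume e: "0 < e"
      obtain C where C: "0 < C" and gron: "\<And>u u' e s. (\<And>s. (u has_vector_derivative u' s) (at s)) \<Longrightarrow> u 0 = 0 \<Longrightarrow> 0 \<le> e \<Longrightarrow>
        (\<And>s. \<bar>s\<bar> \<le> t \<Longrightarrow> norm (u' s - F' (\<phi> s x) (u s)) \<le> e) \<Longrightarrow> \<bar>s\<bar> \<le> t \<Longrightarrow> norm (u s) \<le> C * e"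
        using gronwall_linear[where t = t and x = x] by blast
      \<comment> \<open>Two residuals of size \<open>e'\<close> add up to \<open>2 * e'\<close>, and
        Gronwall turns this into \<open>C * (2 * e') = e / 2\<close>, strictly below e.\<close>
      define e' where "e' = e / (4 * C)"
      have e': "0 < e'" using e C by (simp add: e'_def)
      obtain N where N: "\<And>n s. N \<le> n \<Longrightarrow> \<bar>s\<bar> \<le> t \<Longrightarrow> norm (q' n s - F' (\<phi> s x) (q n s)) \<le> e'"
        using approx[OF e', of t] unfolding eventually_sequentially by blast
      have "dist (q m s) (q n s) < e" if s: "s \<in> {-t..t}" and m: "N \<le> m" and n: "N \<le> n" for s m n
      proof -
        have "norm (q m s - q n s) \<le> C * (2 * e')"
        proof (rule gron[of "\<lambda>s. q m s - q n s" "\<lambda>s. q' m s - q' n s"])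
          show "((\<lambda>s. q m s - q n s) has_vector_derivative q' m s - q' n s) (at s)" for s
            by (intro derivative_intros q)
          show "norm (q' m s - q' n s - F' (\<phi> s x) (q m s - q n s)) \<le> 2 * e'" if "\<bar>s\<bar> \<le> t" for s
          proof -
            have eq: "q' m s - q' n s - F' (\<phi> s x) (q m s - q n s) =
                (q' m s - F' (\<phi> s x) (q m s)) - (q' n s - F' (\<phi> s x) (q n s))"
              by (simp add: blinfun.diff_right)
            show ?thesis
              unfolding eq using N[OF m that] N[OF n that]
                norm_triangle_ineq4[of "q' m s - F' (\<phi> s x) (q m s)" "q' n s - F' (\<phi> s x) (q n s)"]
              by linarith
          qed
        qed (use e' s q0 in \<open>auto simp: abs_le_iff\<close>)
        also have "\<dots> < e" using e C by (simp add: e'_def)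
        finally show ?thesis by (simp add: dist_norm)
      qed
      then show "\<exists>M. \<forall>x\<in>{-t..t}. \<forall>m\<ge>M. \<forall>n\<ge>M. dist (q m x) (q n x) < e" by blast
    qed
    then show ?thesis
      unfolding w_def by (simp add: Cauchy_uniformly_convergent flip: uniformly_convergent_uniform_limit_iff)
  qed
  have lim: "(\<lambda>n. q n s) \<longlonglongrightarrow> w s" for s
    by (rule tendsto_uniform_limitI[OF unif[of "\<bar>s\<bar>"]]) (unfold atLeastAtMost_iff, linarith)
  have "(w has_vector_derivative F' (\<phi> s x) (w s)) (at s)" for s
  proof -
    \<comment> \<open>With this choice s is an interior point of the interval, where the derivative
      within it is the full derivative.\<close>
    define t where "t = \<bar>s\<bar> + 1"
    have s: "- t < s" "s < t" by (auto simp: t_def)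
    obtain L where L: "0 \<le> L" "\<And>s v. \<bar>s\<bar> \<le> t \<Longrightarrow> norm (F' (\<phi> s x) v) \<le> L * norm v"
      using derivative_bounded_along_flow[of t x] by metis
    \<comment> \<open>Differentiating the limit needs uniform convergence of the derivatives
      \<open>q' n\<close>; their limit is found by putting \<open>w\<close> into the variational
      equation.\<close>
    have "\<exists>g. \<forall>r\<in>{-t..t}. (\<lambda>n. q n r) \<longlonglongrightarrow> g r \<and>
        (g has_derivative (\<lambda>h. h *\<^sub>R F' (\<phi> r x) (w r))) (at r within {-t..t})"
    proof (rule has_derivative_sequence[where f' = "\<lambda>n r h. h *\<^sub>R q' n r"])
      show "(q n has_derivative (\<lambda>h. h *\<^sub>R q' n r)) (at r within {-t..t})" for n r
        using q[of n r] unfolding has_vector_derivative_def by (rule has_derivative_at_withinI)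
      show "\<forall>\<^sub>F n in sequentially. \<forall>r\<in>{-t..t}. \<forall>h. norm (h *\<^sub>R q' n r - h *\<^sub>R F' (\<phi> r x) (w r)) \<le> e * norm h"
        if e: "0 < e" for e
      proof -
        \<comment> \<open>Half of e pays for the residual of \<open>q n\<close>, the other half for
          replacing \<open>q n\<close> by its limit under a map of norm at most L.\<close>
        define e' where "e' = e / (2 * (L + 1))"
        have e': "0 < e'" "L * e' \<le> e / 2"
          using e L by (auto simp: e'_def field_simps)
        have half: "0 < e / 2" using e by simp
        from approx[OF half, of t] uniform_limitD[OF unif[of t] e'(1)]
        show ?thesis
        proof (eventually_elim, intro ballI allI)
          fix n r h
          assume n: "\<forall>s. \<bar>s\<bar> \<le> t \<longrightarrow> norm (q' n s - F' (\<phi> s x) (q n s)) \<le> e / 2"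
            "\<forall>s\<in>{-t..t}. dist (q n s) (w s) < e'" and r: "r \<in> {-t..t}"
          then have r': "\<bar>r\<bar> \<le> t" by auto
          have "norm (F' (\<phi> r x) (q n r - w r)) \<le> L * norm (q n r - w r)"
            using L(2)[OF r'] .
          also have "\<dots> \<le> L * e'"
            using n(2) r L(1) by (intro mult_left_mono) (auto simp: dist_norm less_imp_le)
          finally have small: "norm (F' (\<phi> r x) (q n r - w r)) \<le> e / 2" using e' by simp
          have eq: "q' n r - F' (\<phi> r x) (w r) =
              (q' n r - F' (\<phi> r x) (q n r)) + F' (\<phi> r x) (q n r - w r)"
            by (simp add: blinfun.diff_right)
          have "norm (q' n r - F' (\<phi> r x) (w r)) \<le> e"
            unfolding eq using small n(1)[rule_format, OF r']
              norm_triangle_ineq[of "q' n r - F' (\<phi> r x) (q n r)" "F' (\<phi> r x) (q n r - w r)"]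
            by linarith
          then show "norm (h *\<^sub>R q' n r - h *\<^sub>R F' (\<phi> r x) (w r)) \<le> e * norm h"
            by (simp add: mult.commute[of e] mult_left_mono flip: scaleR_diff_right)
        qed
      qed
      show "(\<lambda>n. q n s) \<longlonglongrightarrow> w s" by (rule lim)
    qed (use s in auto)
    then obtain g where g: "\<And>r. r \<in> {-t..t} \<Longrightarrow> (\<lambda>n. q n r) \<longlonglongrightarrow> g r"
      and g': "\<And>r. r \<in> {-t..t} \<Longrightarrow> (g has_derivative (\<lambda>h. h *\<^sub>R F' (\<phi> r x) (w r))) (at r within {-t..t})"
      by blast
    have gw: "g r = w r" if "r \<in> {-t..t}" for r
      using LIMSEQ_unique[OF g[OF that] lim] .
    have "(w has_derivative (\<lambda>h. h *\<^sub>R F' (\<phi> s x) (w s))) (at s within {-t..t})"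
      using g'[of s] s gw has_derivative_transform[of s "{-t..t}" w g] by simp
    then show ?thesis
      unfolding has_vector_derivative_def using s by (simp add: at_within_Icc_at)
  qed
  then have "variational x w" by (simp add: variational_def)
  moreover have "w 0 = v"
    using LIMSEQ_unique[OF lim[of 0]] by (simp add: q0)
  ultimately show thesis by (rule that)
qed

text \<open>For fixed t this is, as a function of v, the candidate for the derivative of the flow.
  The choice is harmless, since \<open>variational_unique\<close> leaves only one solution.\<close>

definition variation :: "'a \<Rightarrow> 'a \<Rightarrow> real \<Rightarrow> 'a" where
  "variation x v = (SOME w. variational x w \<and> w 0 = v)"

lemma variation: "variational x (variation x v)" "variation x v 0 = v"
  using someI_ex[of "\<lambda>w. variational x w \<and> w 0 = v"] variational_exists[of x v]
  unfolding variation_def by blast+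

text \<open>Superposition: both sides solve the variational equation with the same initial
  value.\<close>

lemma linear_variation: "linear (\<lambda>v. variation x v t)"
proof
  fix a b :: 'a and c :: real
  have "variational x (\<lambda>s. variation x a s + variation x b s)"
    using variation(1)[of x] unfolding variational_def
    by (auto intro!: derivative_eq_intros simp: blinfun.add_right)
  from variational_unique[OF variation(1) this, of "a + b"]
  show "variation x (a + b) t = variation x a t + variation x b t"
    by (simp add: variation(2) fun_eq_iff)
  have "variational x (\<lambda>s. c *\<^sub>R variation x a s)"
    using variation(1)[of x a] unfolding variational_def
    by (auto intro!: derivative_eq_intros simp: blinfun.scaleR_right)
  from variational_unique[OF variation(1) this, of "c *\<^sub>R a"]
  show "variation x (c *\<^sub>R a) t = c *\<^sub>R variation x a t"
    by (simp add: variation(2) fun_eq_iff)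
qed

text \<open>The first-order remainder vanishes at time 0 and solves the variational equation up to
  the error of \<open>flow_linearization\<close>, so Gronwall bounds it by a small multiple of the
  initial distance.\<close>

lemma flow_has_derivative: "(\<phi> t has_derivative (\<lambda>v. variation x v t)) (at x)"
  unfolding has_derivative_at_alt
proof (intro conjI allI impI)
  show "bounded_linear (\<lambda>v. variation x v t)"
    using linear_variation by (simp add: linear_conv_bounded_linear)
  fix e :: real assume e: "0 < e"
  obtain C where C: "0 < C" and gron: "\<And>u u' e s. (\<And>s. (u has_vector_derivative u' s) (at s)) \<Longrightarrow> u 0 = 0 \<Longrightarrow> 0 \<le> e \<Longrightarrow>
    (\<And>s. \<bar>s\<bar> \<le> \<bar>t\<bar> \<Longrightarrow> norm (u' s - F' (\<phi> s x) (u s)) \<le> e) \<Longrightarrow> \<bar>s\<bar> \<le> \<bar>t\<bar> \<Longrightarrow> norm (u s) \<le> C * e"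
    using gronwall_linear[where t = "\<bar>t\<bar>" and x = x] by blast
  have "0 < e / C" using e C by simp
  then obtain d where d: "0 < d" and lin: "\<And>y s. norm (y - x) < d \<Longrightarrow> \<bar>s\<bar> \<le> \<bar>t\<bar> \<Longrightarrow>
      norm (F (\<phi> s y) - F (\<phi> s x) - F' (\<phi> s x) (\<phi> s y - \<phi> s x)) \<le> e / C * norm (y - x)"
    using flow_linearization[of _ x "\<bar>t\<bar>"] by metis
  show "\<exists>d>0. \<forall>y. norm (y - x) < d \<longrightarrow>
      norm (\<phi> t y - \<phi> t x - variation x (y - x) t) \<le> e * norm (y - x)"
  proof (intro exI conjI allI impI)
    fix y assume y: "norm (y - x) < d"
    let ?w = "variation x (y - x)"
    have "norm (\<phi> t y - \<phi> t x - ?w t) \<le> C * (e / C * norm (y - x))"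
    proof (rule gron)
      show "((\<lambda>s. \<phi> s y - \<phi> s x - ?w s) has_vector_derivative
          F (\<phi> s y) - F (\<phi> s x) - F' (\<phi> s x) (?w s)) (at s)" for s
        using variation(1)[of x "y - x"] unfolding variational_def
        by (intro derivative_intros flow) auto
      show "norm (F (\<phi> s y) - F (\<phi> s x) - F' (\<phi> s x) (?w s) - F' (\<phi> s x) (\<phi> s y - \<phi> s x - ?w s))
          \<le> e / C * norm (y - x)" if "\<bar>s\<bar> \<le> \<bar>t\<bar>" for s
        using lin[OF y that] by (simp add: blinfun.diff_right)
    qed (use e C in \<open>auto simp: init variation(2)\<close>)
    then show "norm (\<phi> t y - \<phi> t x - ?w t) \<le> e * norm (y - x)"
      using C by simp
  qed (rule d)
qed

lemma variation_eq: "variation x v t = frechet_derivative (\<phi> t) (at x) v"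
  using frechet_derivative_at[OF flow_has_derivative[of t x]] by metis

lemma variation_has_derivative:
  "((\<lambda>s. variation x v s) has_vector_derivative F' (\<phi> t x) (variation x v t)) (at t)"
  using variation(1)[of x v] by (simp add: variational_def)

end

section \<open>The tangent field and the second derivative of the flow\<close>

lemma C1_blinfun_derivative:
  fixes F :: "'a::euclidean_space \<Rightarrow> 'b::real_normed_vector"
  assumes "Ck_on (Suc 0) UNIV F"
  obtains F' :: "'a \<Rightarrow> 'a \<Rightarrow>\<^sub>L 'b"
  where "\<And>x. (F has_derivative F' x) (at x)" "continuous_on UNIV F'"
proof
  define F' where "F' x = Blinfun (frechet_derivative F (at x))" for x
  have works: "(F has_derivative frechet_derivative F (at x)) (at x)" for x
    using assms by (simp add: frechet_derivative_works)
  then have F': "blinfun_apply (F' x) = frechet_derivative F (at x)" for x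
    unfolding F'_def by (intro bounded_linear_Blinfun_apply has_derivative_bounded_linear)
  show "(F has_derivative F' x) (at x)" for x
    using works by (simp add: F')
  \<comment> \<open>In finite dimension, continuity of the derivative in each fixed direction gives
    continuity in the operator norm.\<close>
  show "continuous_on UNIV F'"
    using assms by (intro continuous_on_blinfun_componentwise) (simp add: F')
qed

lemma C1_I:
  assumes "\<And>x. (F has_derivative D x) (at x)" "\<And>h. continuous_on UNIV (\<lambda>x. D x h)"
  shows "Ck_on (Suc 0) UNIV F"
proof -
  have "frechet_derivative F (at x) = D x" for x
    using frechet_derivative_at[OF assms(1)] by simp
  then show ?thesis
    using assms by (auto simp: differentiable_def)
qed

lemma Ck_on_Suc_imp_continuous: "Ck_on (Suc k) U f \<Longrightarrow> continuous_on U f"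
  by (rule differentiable_imp_continuous_on) (simp add: differentiable_on_def differentiable_at_withinI)

lemma Ck_on_mono_Suc: "Ck_on (Suc k) U f \<Longrightarrow> Ck_on k U f"
proof (induction k arbitrary: f)
  case 0
  then show ?case by (simp only: Ck_on.simps(1) Ck_on_Suc_imp_continuous)
next
  case (Suc k)
  then have "Ck_on k U (\<lambda>x. frechet_derivative f (at x) v)" for v
    by (intro Suc.IH) (simp only: Ck_on.simps(2)[of "Suc k"])
  then show ?case using Suc.prems by simp
qed

text \<open>The second component is the derivative of \<open>F\<close> at \<open>fst p\<close> in direction \<open>snd p\<close>, expanded in
  the basis because \<^const>\<open>Ck_on\<close> controls the derivative only for fixed directions.\<close>

definition tangent_field ::
    "('a::euclidean_space \<Rightarrow> 'a) \<Rightarrow> 'a \<times> 'a \<Rightarrow> 'a \<times> 'a" where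
  "tangent_field F p =
     (F (fst p), \<Sum>i\<in>Basis. (snd p \<bullet> i) *\<^sub>R frechet_derivative F (at (fst p)) i)"

text \<open>The second component is a sum of products of coordinates of \<open>snd p\<close> with
  the directional derivatives of F along basis vectors, each of which is C1.\<close>

lemma tangent_field_C1:
  fixes F :: "'a::euclidean_space \<Rightarrow> 'a"
  assumes "Ck_on (Suc (Suc 0)) UNIV F"
  shows "Ck_on (Suc 0) UNIV (tangent_field F)"
proof -
  let ?G = "\<lambda>i x. frechet_derivative F (at x) i"
  have F: "Ck_on (Suc 0) UNIV F" and G: "Ck_on (Suc 0) UNIV (?G i)" for i
    using assms Ck_on_mono_Suc[of "Suc 0" UNIV F] by auto
  have F': "(F has_derivative frechet_derivative F (at x)) (at x)" for x
    using F by (simp add: frechet_derivative_works)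
  have G': "(?G i has_derivative frechet_derivative (?G i) (at x)) (at x)" for x i
    using G[of i] by (simp add: frechet_derivative_works)
  have cG: "continuous_on UNIV (?G i)" for i
    using F by simp
  have cG': "continuous_on UNIV (\<lambda>x. frechet_derivative (?G i) (at x) h)" for i h
    using G[of i] by simp
  show ?thesis
  proof (rule C1_I)
    fix p :: "'a \<times> 'a"
    show "(tangent_field F has_derivative (\<lambda>h. (frechet_derivative F (at (fst p)) (fst h),
        \<Sum>i\<in>Basis. (snd p \<bullet> i) *\<^sub>R frechet_derivative (?G i) (at (fst p)) (fst h)
          + (snd h \<bullet> i) *\<^sub>R ?G i (fst p)))) (at p)"
      unfolding tangent_field_def[abs_def]
      by (intro has_derivative_Pair has_derivative_sum has_derivative_scaleR
          has_derivative_inner_left has_derivative_snd has_derivative_ident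
          has_derivative_compose[OF has_derivative_fst[OF has_derivative_ident] F']
          has_derivative_compose[OF has_derivative_fst[OF has_derivative_ident] G'])
  next
    fix h :: "'a \<times> 'a"
    show "continuous_on UNIV (\<lambda>p. (frechet_derivative F (at (fst p)) (fst h),
        \<Sum>i\<in>Basis. (snd p \<bullet> i) *\<^sub>R frechet_derivative (?G i) (at (fst p)) (fst h)
          + (snd h \<bullet> i) *\<^sub>R ?G i (fst p)))"
      by (intro continuous_intros continuous_on_compose2[OF cG continuous_on_fst]
          continuous_on_compose2[OF cG' continuous_on_fst]) auto
  qed
qed

lemma C1_flow_exists:
  assumes "Ck_on (Suc 0) UNIV F" "\<And>x. \<phi> 0 x = x"
    "\<And>x t. ((\<lambda>s. \<phi> s x) has_vector_derivative F (\<phi> t x)) (at t)"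
  obtains F' where "C1_flow F F' \<phi>"
  using C1_blinfun_derivative[OF assms(1)] assms(2,3) unfolding C1_flow_def by metis

context C1_flow
begin

lemma tangent_field_variation:
  "tangent_field F (\<phi> t x, variation x v t) = (F (\<phi> t x), F' (\<phi> t x) (variation x v t))"
proof -
  have F': "frechet_derivative F (at y) = F' y" for y
    using frechet_derivative_at[OF deriv] by simp
  have "F' (\<phi> t x) (variation x v t) = F' (\<phi> t x) (\<Sum>i\<in>Basis. (variation x v t \<bullet> i) *\<^sub>R i)"
    by (simp add: euclidean_representation)
  also have "\<dots> = (\<Sum>i\<in>Basis. (variation x v t \<bullet> i) *\<^sub>R F' (\<phi> t x) i)"
    by (simp only: blinfun.sum_right blinfun.scaleR_right)
  finally show ?thesis by (simp add: tangent_field_def F')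
qed

text \<open>The flow together with its derivative is the flow of the tangent field, so the first-order
  result applies to it once more.\<close>

lemma flow_twice_differentiable:
  assumes "Ck_on (Suc (Suc 0)) UNIV F"
  shows "(\<lambda>x. frechet_derivative (\<phi> t) (at x) v) differentiable (at x)"
proof -
  define \<Phi> where "\<Phi> t p = (\<phi> t (fst p), variation (fst p) (snd p) t)" for t and p :: "'a \<times> 'a"
  have "((\<lambda>s. \<Phi> s p) has_vector_derivative tangent_field F (\<Phi> t p)) (at t)" for p t
    unfolding \<Phi>_def tangent_field_variation
    by (intro has_vector_derivative_Pair flow variation_has_derivative)
  moreover have "\<Phi> 0 p = p" for p
    by (simp add: \<Phi>_def init variation(2))
  ultimately obtain T' where "C1_flow (tangent_field F) T' \<Phi>"
    using C1_flow_exists[OF tangent_field_C1[OF assms]] by metis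
  then have "\<Phi> t differentiable (at (x, v))"
    unfolding differentiable_def using C1_flow.flow_has_derivative by blast
  then obtain D where "(\<Phi> t has_derivative D) (at (x, v))"
    unfolding differentiable_def by blast
  \<comment> \<open>Freezing the vector v and projecting to the second component leaves the
    derivative of the flow at y in direction v, as a function of y.\<close>
  then have "((\<lambda>y. snd (\<Phi> t (y, v))) has_derivative (\<lambda>h. snd (D (h, 0)))) (at x)"
    by (intro has_derivative_snd has_derivative_compose[of "\<lambda>y. (y, v)" _ x UNIV "\<Phi> t"]
        has_derivative_Pair has_derivative_ident has_derivative_const) auto
  then show ?thesis
    unfolding differentiable_def by (auto simp: \<Phi>_def variation_eq)
qed

lemma flow_differentiable: "\<phi> t differentiable (at x)"
  using flow_has_derivative unfolding differentiable_def by blast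

lemma flow_continuous: "continuous_on S (\<phi> t)"
  by (intro continuous_at_imp_continuous_on ballI differentiable_imp_continuous_within flow_differentiable)

lemma homeomorphism_flow: "homeomorphism UNIV UNIV (\<phi> t) (\<phi> (- t))"
  unfolding homeomorphism_def
  by (auto simp: flow_inverse flow_continuous) (metis flow_inverse rangeI)+

end

section \<open>Locality of \<open>Ck_on\<close>\<close>

lemma frechet_derivative_cong_open:
  assumes "open U" "x \<in> U" "\<And>y. y \<in> U \<Longrightarrow> f y = g y"
  shows "f differentiable (at x) \<longleftrightarrow> g differentiable (at x)"
    "frechet_derivative f (at x) = frechet_derivative g (at x)"
proof -
  \<comment> \<open>\<open>frechet_derivative\<close> is a choice among all derivatives; if f and g
    admit the same ones, the choices coincide.\<close>
  have "(f has_derivative D) (at x) \<longleftrightarrow> (g has_derivative D) (at x)" for D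
    using has_derivative_transform_within_open[of f D x UNIV U g]
      has_derivative_transform_within_open[of g D x UNIV U f] assms by auto
  then show "f differentiable (at x) \<longleftrightarrow> g differentiable (at x)"
    "frechet_derivative f (at x) = frechet_derivative g (at x)"
    by (simp_all add: differentiable_def frechet_derivative_def)
qed

lemma Ck_on_cong_open:
  "open U \<Longrightarrow> (\<And>y. y \<in> U \<Longrightarrow> f y = g y) \<Longrightarrow> Ck_on k U f \<Longrightarrow> Ck_on k U g"
proof (induction k arbitrary: f g)
  case 0
  then show ?case by (simp cong: continuous_on_cong)
next
  case (Suc k)
  note cong = frechet_derivative_cong_open[OF Suc.prems(1) _ Suc.prems(2)]
  show ?case
    unfolding Ck_on.simps
  proof (intro conjI ballI allI)
    fix x assume "x \<in> U"
    then show "g differentiable (at x)" using Suc.prems(3) cong(1) by simp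
  next
    fix v
    show "Ck_on k U (\<lambda>x. frechet_derivative g (at x) v)"
    proof (rule Suc.IH[OF Suc.prems(1)])
      show "Ck_on k U (\<lambda>x. frechet_derivative f (at x) v)" using Suc.prems(3) by simp
    qed (simp add: cong(2))
  qed
qed

text \<open>\<open>smooth_on\<close> supplies only local representatives. They can be glued since
  \<open>Ck_on\<close> takes derivatives over full neighbourhoods.\<close>

lemma Ck_on_local:
  "(\<And>p. p \<in> S \<Longrightarrow> \<exists>U. open U \<and> p \<in> U \<and> Ck_on k U f) \<Longrightarrow> Ck_on k S f"
proof (induction k arbitrary: f)
  case 0
  show ?case
    unfolding Ck_on.simps
  proof (intro continuous_at_imp_continuous_on ballI)
    fix p assume "p \<in> S"
    then obtain U where "open U" "p \<in> U" "continuous_on U f"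
      using 0 by auto
    then show "isCont f p"
      using continuous_on_eq_continuous_at by blast
  qed
next
  case (Suc k)
  have "\<exists>U. open U \<and> p \<in> U \<and> Ck_on k U (\<lambda>x. frechet_derivative f (at x) v)" if "p \<in> S" for p v
    using Suc.prems[OF that] by auto
  then have "Ck_on k S (\<lambda>x. frechet_derivative f (at x) v)" for v
    by (rule Suc.IH)
  then show ?case
    using Suc.prems by auto
qed

lemma smooth_on_UNIV: "smooth_on UNIV f \<Longrightarrow> Ck_on k UNIV f"
  unfolding smooth_on_def by (rule Ck_on_local) (metis Ck_on_cong_open Int_UNIV_right UNIV_I)

section \<open>The chain rule for the Laplacian\<close>

lemma partial_eq_derivative:
  assumes "(u has_derivative u') (at y)"
  shows "partial i u y = u' (axis i 1)"
proof -
  have u': "linear u'" using assms by (rule has_derivative_linear)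
  have "((\<lambda>h. u (y + h *\<^sub>R axis i 1)) has_derivative (\<lambda>h. u' (h *\<^sub>R axis i 1))) (at 0)"
    by (rule has_derivative_compose[of "\<lambda>h. y + h *\<^sub>R axis i 1" "\<lambda>h. h *\<^sub>R axis i 1" 0 UNIV u])
      (auto intro!: derivative_eq_intros simp: assms)
  then have "((\<lambda>h. u (y + h *\<^sub>R axis i 1)) has_real_derivative u' (axis i 1)) (at 0)"
    by (simp add: has_field_derivative_def linear_cmul[OF u'] mult.commute[of _ "u' (axis i 1)"])
  then show ?thesis
    unfolding partial_def by (rule DERIV_imp_deriv)
qed

lemma derivative_eq_grad:
  assumes "(u has_derivative u') (at y)"
  shows "u' v = grad u y \<bullet> v"
proof -
  have u': "linear u'" using assms by (rule has_derivative_linear)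
  have "u' v = u' (\<Sum>i\<in>UNIV. (v $ i) *\<^sub>R axis i 1)"
    using basis_expansion[of v] by (simp add: scalar_mult_eq_scaleR)
  also have "\<dots> = (\<Sum>i\<in>UNIV. v $ i * u' (axis i 1))"
    by (simp add: linear_sum[OF u'] linear_cmul[OF u'])
  finally show ?thesis
    by (simp add: inner_vec_def grad_def partial_eq_derivative[OF assms] mult.commute)
qed

lemma partial_cong_open:
  assumes "open U" "y \<in> U" "\<And>z. z \<in> U \<Longrightarrow> u z = v z"
  shows "partial i u y = partial i v y"
  unfolding partial_def
proof (rule deriv_cong_ev)
  have "open ((\<lambda>h. y + h *\<^sub>R axis i 1) -` U)"
    by (intro open_vimage assms(1) continuous_intros)
  then have "\<forall>\<^sub>F h in nhds 0. h \<in> (\<lambda>h. y + h *\<^sub>R axis i 1) -` U"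
    using assms(2) by (intro eventually_nhds_in_open) auto
  then show "\<forall>\<^sub>F h in nhds 0. u (y + h *\<^sub>R axis i 1) = v (y + h *\<^sub>R axis i 1)"
    by eventually_elim (simp add: assms(3))
qed simp

lemma partial_mult:
  assumes "u differentiable (at y)" "v differentiable (at y)"
  shows "partial i (\<lambda>z. u z * v z) y = partial i u y * v y + u y * partial i v y"
proof -
  from assms obtain u' v' where d: "(u has_derivative u') (at y)" "(v has_derivative v') (at y)"
    unfolding differentiable_def by blast
  from partial_eq_derivative[OF has_derivative_mult[OF this]] show ?thesis
    by (simp add: d[THEN partial_eq_derivative])
qed

lemma partial_cmult:
  assumes "u differentiable (at y)"
  shows "partial i (\<lambda>z. c * u z) y = c * partial i u y"
proof -
  from assms obtain u' where d: "(u has_derivative u') (at y)"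
    unfolding differentiable_def by blast
  from partial_eq_derivative[OF has_derivative_mult_right[OF this]] show ?thesis
    by (simp add: d[THEN partial_eq_derivative])
qed

lemma partial_sum:
  assumes "\<And>j. j \<in> I \<Longrightarrow> u j differentiable (at y)"
  shows "partial i (\<lambda>z. \<Sum>j\<in>I. u j z) y = (\<Sum>j\<in>I. partial i (u j) y)"
proof -
  from assms obtain u' where d: "\<And>j. j \<in> I \<Longrightarrow> (u j has_derivative u' j) (at y)"
    unfolding differentiable_def by metis
  from partial_eq_derivative[OF has_derivative_sum[OF this]] show ?thesis
    by (simp add: partial_eq_derivative[OF d])
qed

lemma differentiable_vec_nth:
  fixes p :: "'a::real_normed_vector \<Rightarrow> real^'m"
  shows "p differentiable (at y) \<Longrightarrow> (\<lambda>z. p z $ i) differentiable (at y)"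
  unfolding differentiable_def by (auto intro: bounded_linear.has_derivative[OF bounded_linear_vec_nth])

lemma partial_compose:
  fixes p :: "real^'n \<Rightarrow> real^'m"
  assumes "u differentiable (at (p y))" "p differentiable (at y)"
  shows "partial j (\<lambda>z. u (p z)) y = (\<Sum>i\<in>UNIV. partial i u (p y) * partial j (\<lambda>z. p z $ i) y)"
proof -
  from assms obtain u' p' where d: "(u has_derivative u') (at (p y))" "(p has_derivative p') (at y)"
    unfolding differentiable_def by blast
  have "partial j (\<lambda>z. u (p z)) y = grad u (p y) \<bullet> p' (axis j 1)"
    using partial_eq_derivative[OF has_derivative_compose[OF d(2,1)]] derivative_eq_grad[OF d(1)] by simp
  moreover have "partial j (\<lambda>z. p z $ i) y = p' (axis j 1) $ i" for i
    by (rule partial_eq_derivative) (rule bounded_linear.has_derivative[OF bounded_linear_vec_nth d(2)])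
  ultimately show ?thesis by (simp add: inner_vec_def grad_def)
qed

text \<open>Differentiability of u is demanded and not mere existence of its partial derivatives,
  which would not support the chain rule; the same holds for each
  \<open>partial i u\<close>.\<close>

definition twice_differentiable_on :: "(real^'n) set \<Rightarrow> (real^'n \<Rightarrow> real) \<Rightarrow> bool" where
  "twice_differentiable_on U u \<longleftrightarrow>
     (\<forall>y\<in>U. u differentiable (at y) \<and> (\<forall>i. partial i u differentiable (at y)))"

lemma differentiable_cong_open:
  assumes "open U" "x \<in> U" "\<And>y. y \<in> U \<Longrightarrow> f y = g y" "f differentiable (at x)"
  shows "g differentiable (at x)"
  using frechet_derivative_cong_open(1)[OF assms(1-3)] assms(4) by simp

lemma twice_differentiable_on_cong:
  assumes "open U" "\<And>y. y \<in> U \<Longrightarrow> u y = v y" "twice_differentiable_on U u"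
  shows "twice_differentiable_on U v"
  unfolding twice_differentiable_on_def
proof (intro ballI conjI allI)
  fix y i assume y: "y \<in> U"
  show "v differentiable (at y)"
    using assms y by (auto simp: twice_differentiable_on_def intro: differentiable_cong_open)
  show "partial i v differentiable (at y)"
  proof (rule differentiable_cong_open[OF assms(1) y])
    show "partial i u z = partial i v z" if "z \<in> U" for z
      using partial_cong_open[OF assms(1) that assms(2)] .
  qed (use assms y in \<open>auto simp: twice_differentiable_on_def\<close>)
qed

lemma twice_differentiable_on_partial_compose:
  fixes p :: "real^'n \<Rightarrow> real^'m"
  assumes "twice_differentiable_on B u" "p ` U \<subseteq> B" "\<And>y. y \<in> U \<Longrightarrow> p differentiable (at y)"
    and "y \<in> U"
  shows "u differentiable (at (p y))" "(\<lambda>z. partial i u (p z)) differentiable (at y)"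
  using assms differentiable_compose[of "partial i u" p y UNIV]
  unfolding twice_differentiable_on_def by auto

lemma twice_differentiable_on_compose:
  fixes p :: "real^'n \<Rightarrow> real^'m"
  assumes U: "open U" and u: "twice_differentiable_on B u" and p: "p ` U \<subseteq> B"
    and p': "\<And>y. p differentiable (at y)"
    and p'': "\<And>i. twice_differentiable_on U (\<lambda>z. p z $ i)"
  shows "twice_differentiable_on U (\<lambda>z. u (p z))"
  unfolding twice_differentiable_on_def
proof (intro ballI conjI allI)
  fix y j assume y: "y \<in> U"
  note comp = twice_differentiable_on_partial_compose[OF u p p']
  show "(\<lambda>z. u (p z)) differentiable (at y)"
    using comp(1)[OF y] p'[of y] differentiable_compose[of u p y UNIV] by simp
  show "partial j (\<lambda>z. u (p z)) differentiable (at y)"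
  proof (rule differentiable_cong_open[OF U y])
    show "(\<Sum>i\<in>UNIV. partial i u (p z) * partial j (\<lambda>z. p z $ i) z) = partial j (\<lambda>z. u (p z)) z"
      if "z \<in> U" for z
      using partial_compose[OF comp(1)[OF that] p'] by simp
    show "(\<lambda>z. \<Sum>i\<in>UNIV. partial i u (p z) * partial j (\<lambda>z. p z $ i) z) differentiable (at y)"
      using comp(2)[OF y] p'' y
      by (intro differentiable_sum differentiable_mult ballI) (auto simp: twice_differentiable_on_def)
  qed
qed

text \<open>For p = \<psi>(t), the sums over j on the right are \<open>coeff_a\<close> and
  \<open>coeff_s\<close>. They arise from the chain rule for u, the product rule, and the chain rule
  again for each \<open>partial i u\<close>.\<close>

lemma laplacian_compose:
  fixes p :: "real^'n \<Rightarrow> real^'m"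
  assumes U: "open U" and u: "twice_differentiable_on B u" and p: "p ` U \<subseteq> B"
    and p': "\<And>y. p differentiable (at y)"
    and p'': "\<And>i. twice_differentiable_on U (\<lambda>z. p z $ i)" and y: "y \<in> U"
  shows "laplacian (\<lambda>z. u (p z)) y =
    (\<Sum>l\<in>UNIV. \<Sum>i\<in>UNIV. (\<Sum>j\<in>UNIV. partial j (\<lambda>z. p z $ l) y * partial j (\<lambda>z. p z $ i) y)
       * partial l (partial i u) (p y))
    + (\<Sum>i\<in>UNIV. (\<Sum>j\<in>UNIV. partial j (partial j (\<lambda>z. p z $ i)) y) * partial i u (p y))"
proof -
  note comp = twice_differentiable_on_partial_compose[OF u p p']
  have p''y: "partial j (\<lambda>z. p z $ i) differentiable (at y)" for i j
    using p'' y by (auto simp: twice_differentiable_on_def)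
  have u''y: "partial i u differentiable (at (p y))" for i
    using u p y by (auto simp: twice_differentiable_on_def)
  have "partial j (partial j (\<lambda>z. u (p z))) y =
      (\<Sum>i\<in>UNIV. \<Sum>l\<in>UNIV. partial j (\<lambda>z. p z $ l) y * partial j (\<lambda>z. p z $ i) y
         * partial l (partial i u) (p y))
      + (\<Sum>i\<in>UNIV. partial j (partial j (\<lambda>z. p z $ i)) y * partial i u (p y))" for j
  proof -
    \<comment> \<open>The first-order formula holds throughout the open set U, hence it may be
      differentiated at y.\<close>
    have "partial j (partial j (\<lambda>z. u (p z))) y =
        partial j (\<lambda>z. \<Sum>i\<in>UNIV. partial i u (p z) * partial j (\<lambda>z. p z $ i) z) y"
      using partial_compose[OF comp(1) p'] by (intro partial_cong_open[OF U y]) simp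
    also have "\<dots> = (\<Sum>i\<in>UNIV. partial j (\<lambda>z. partial i u (p z) * partial j (\<lambda>z. p z $ i) z) y)"
      using comp(2)[OF y] p''y by (intro partial_sum differentiable_mult) auto
    also have "\<dots> = (\<Sum>i\<in>UNIV. partial j (\<lambda>z. partial i u (p z)) y * partial j (\<lambda>z. p z $ i) y
        + partial i u (p y) * partial j (partial j (\<lambda>z. p z $ i)) y)"
      using comp(2)[OF y] p''y by (intro sum.cong partial_mult) auto
    also have "\<dots> = (\<Sum>i\<in>UNIV. (\<Sum>l\<in>UNIV. partial l (partial i u) (p y) * partial j (\<lambda>z. p z $ l) y)
        * partial j (\<lambda>z. p z $ i) y
        + partial i u (p y) * partial j (partial j (\<lambda>z. p z $ i)) y)"
      by (simp add: partial_compose[OF u''y p'])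
    finally show ?thesis
      by (simp add: sum.distrib sum_distrib_left mult_ac)
  qed
  then have "laplacian (\<lambda>z. u (p z)) y =
      (\<Sum>j\<in>UNIV. \<Sum>i\<in>UNIV. \<Sum>l\<in>UNIV. partial j (\<lambda>z. p z $ l) y * partial j (\<lambda>z. p z $ i) y
         * partial l (partial i u) (p y))
      + (\<Sum>j\<in>UNIV. \<Sum>i\<in>UNIV. partial j (partial j (\<lambda>z. p z $ i)) y * partial i u (p y))"
    by (simp add: laplacian_def sum.distrib)
  also have "(\<Sum>j\<in>UNIV. \<Sum>i\<in>UNIV. partial j (partial j (\<lambda>z. p z $ i)) y * partial i u (p y)) =
      (\<Sum>i\<in>UNIV. (\<Sum>j\<in>UNIV. partial j (partial j (\<lambda>z. p z $ i)) y) * partial i u (p y))"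
    by (subst sum.swap) (simp add: sum_distrib_right)
  also have "(\<Sum>j\<in>UNIV. \<Sum>i\<in>UNIV. \<Sum>l\<in>UNIV. partial j (\<lambda>z. p z $ l) y * partial j (\<lambda>z. p z $ i) y
         * partial l (partial i u) (p y)) =
      (\<Sum>i\<in>UNIV. \<Sum>l\<in>UNIV. \<Sum>j\<in>UNIV. partial j (\<lambda>z. p z $ l) y * partial j (\<lambda>z. p z $ i) y
         * partial l (partial i u) (p y))"
    by (subst sum.swap, intro sum.cong refl, rule sum.swap)
  also have "\<dots> = (\<Sum>l\<in>UNIV. \<Sum>i\<in>UNIV. (\<Sum>j\<in>UNIV. partial j (\<lambda>z. p z $ l) y * partial j (\<lambda>z. p z $ i) y)
       * partial l (partial i u) (p y))"
    by (subst sum.swap) (simp add: sum_distrib_right)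
  finally show ?thesis .
qed

text \<open>A partial derivative of the slice is the derivative of g in a direction with time
  component 0, and \<open>Ck_on\<close> makes that function differentiable.\<close>

lemma twice_differentiable_on_slice:
  fixes g :: "(real^'n) \<times> real \<Rightarrow> real"
  assumes W: "open W" and g: "Ck_on (Suc (Suc 0)) W g"
  shows "twice_differentiable_on {z. (z, t) \<in> W} (\<lambda>z. g (z, t))"
proof -
  have slice: "((\<lambda>z. (z, t)) has_derivative (\<lambda>h. (h, 0))) (at z)" for z :: "real^'n"
    by (intro has_derivative_Pair has_derivative_ident has_derivative_const)
  have g': "((\<lambda>z. g (z, t)) has_derivative (\<lambda>h. frechet_derivative g (at (z, t)) (h, 0))) (at z)"
    if "(z, t) \<in> W" for z
    by (rule has_derivative_compose[OF slice]) (use g that in \<open>simp flip: frechet_derivative_works\<close>)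
  have partial: "partial i (\<lambda>z. g (z, t)) z = frechet_derivative g (at (z, t)) (axis i 1, 0)"
    if "(z, t) \<in> W" for z i
    using partial_eq_derivative[OF g'[OF that]] .
  have open_slice: "open {z. (z, t) \<in> W}"
    using open_vimage[OF W, of "\<lambda>z. (z, t)"] by (simp add: vimage_def continuous_on_Pair)
  show ?thesis
    unfolding twice_differentiable_on_def
  proof (intro ballI conjI allI)
    fix y i assume y: "y \<in> {z. (z, t) \<in> W}"
    then show "(\<lambda>z. g (z, t)) differentiable (at y)"
      using g' unfolding differentiable_def by blast
    show "partial i (\<lambda>z. g (z, t)) differentiable (at y)"
    proof (rule differentiable_cong_open[OF open_slice y])
      have "(\<lambda>q. frechet_derivative g (at q) (axis i 1, 0)) differentiable (at (y, t))"
        using g y by simp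
      then show "(\<lambda>z. frechet_derivative g (at (z, t)) (axis i 1, 0)) differentiable (at y)"
        using slice has_derivative_compose unfolding differentiable_def by blast
    qed (simp add: partial)
  qed
qed

lemma divergence_scaleR:
  assumes "u differentiable (at y)" "V differentiable (at y)"
  shows "divergence (\<lambda>z. u z *\<^sub>R V z) y = grad u y \<bullet> V y + u y * divergence V y"
  using assms
  by (simp add: divergence_def partial_mult differentiable_vec_nth sum.distrib inner_vec_def
      grad_def sum_distrib_left)

text \<open>Used with c = -k. The flux law is known only inside the domain, whose openness allows
  differentiating it there.\<close>

lemma divergence_grad:
  assumes "open U" "y \<in> U" "twice_differentiable_on U u" "\<And>z. z \<in> U \<Longrightarrow> W z = c *\<^sub>R grad u z"
  shows "divergence W y = c * laplacian u y"
proof -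
  have "partial i (\<lambda>z. W z $ i) y = partial i (\<lambda>z. c * partial i u z) y" for i
    using assms(4) by (intro partial_cong_open[OF assms(1,2)]) (simp add: grad_def)
  also have "\<dots> i = c * partial i (partial i u) y" for i
    using assms(2,3) by (intro partial_cmult) (auto simp: twice_differentiable_on_def)
  finally show ?thesis
    by (simp add: divergence_def laplacian_def sum_distrib_left)
qed

section \<open>Transport of the equations by the flow\<close>

lemma homeomorphism_frontier_image:
  assumes "homeomorphism UNIV UNIV f g"
  shows "frontier (f ` S) = f ` frontier S"
  using homeomorphic_map_frontier_of[of euclidean euclidean f S] assms
  by (force simp: homeomorphic_map_maps homeomorphic_maps_def homeomorphism_def euclidean_frontier_of)

text \<open>Even at t = 0 the filter is nontrivial, as it contains the approach from the right;
  hence the one-sided derivative is unique.\<close>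

lemma vector_derivative_at_within_atLeast:
  fixes t :: real
  assumes "0 \<le> t" "(f has_vector_derivative f') (at t within {0..})"
  shows "vector_derivative f (at t within {0..}) = f'"
proof (rule vector_derivative_within[OF _ assms(2)])
  have "at_right t \<le> at t within {0..}"
    using assms(1) by (intro at_le) auto
  then show "at t within {0..} \<noteq> bot"
    using trivial_limit_at_right_real[of t] by (metis bot.extremum_uniqueI)
qed

lemma flow_C1:
  assumes "smooth_on UNIV V" "flow_of V \<phi>"
  obtains V' where "C1_flow V V' \<phi>"
  using C1_flow_exists[OF smooth_on_UNIV[OF assms(1)], of \<phi>] assms(2)
  unfolding flow_of_def by metis

text \<open>The sign of t is arbitrary, so this covers both \<phi>(t) and its inverse
  \<phi>(-t).\<close>

lemma flow_component_twice_differentiable: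
  assumes "smooth_on UNIV V" "flow_of V \<phi>"
  shows "twice_differentiable_on U (\<lambda>z. \<phi> t z $ i)"
proof -
  obtain V' where "C1_flow V V' \<phi>" using flow_C1[OF assms] .
  then interpret C1_flow V V' \<phi> .
  have "partial j (\<lambda>z. \<phi> t z $ i) = (\<lambda>z. frechet_derivative (\<phi> t) (at z) (axis j 1) $ i)" for j
  proof
    fix z
    have "(\<phi> t has_derivative frechet_derivative (\<phi> t) (at z)) (at z)"
      using flow_differentiable by (simp add: frechet_derivative_works)
    from partial_eq_derivative[OF bounded_linear.has_derivative[OF bounded_linear_vec_nth this]]
    show "partial j (\<lambda>z. \<phi> t z $ i) z = frechet_derivative (\<phi> t) (at z) (axis j 1) $ i" .
  qed
  then show ?thesis
    unfolding twice_differentiable_on_def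
    using flow_differentiable flow_twice_differentiable[OF smooth_on_UNIV[OF assms(1)]]
    by (auto intro!: differentiable_vec_nth)
qed

section \<open>The equations on the moving domain and their pullback\<close>

locale moving_domain_problem =
  fixes \<Omega>\<^sub>0 :: "(real^'n) set" and V :: "real^'n \<Rightarrow> real^'n"
    and \<phi> :: "real \<Rightarrow> real^'n \<Rightarrow> real^'n" and T :: "real^'n \<Rightarrow> real \<Rightarrow> real"
  assumes open_domain: "open \<Omega>\<^sub>0"
    and smooth_V: "smooth_on UNIV V"
    and flow_V: "flow_of V \<phi>"
    and smooth_T: "smooth_on {(y, t). 0 \<le> t \<and> y \<in> closure (\<phi> t ` \<Omega>\<^sub>0)} (\<lambda>(y, t). T y t)"
begin

text \<open>The operator-valued derivative is a locale parameter, but \<open>flow_C1\<close> asserts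
  only that one exists; \<open>SOME\<close> gives it a name.\<close>

sublocale C1_flow V "SOME V'. C1_flow V V' \<phi>" \<phi>
  using flow_C1[OF smooth_V flow_V] by (metis someI)

lemma in_domain_iff: "y \<in> \<phi> t ` \<Omega>\<^sub>0 \<longleftrightarrow> \<phi> (- t) y \<in> \<Omega>\<^sub>0"
  using flow_inverse by (metis image_iff)

lemma open_moving_domain: "open (\<phi> t ` \<Omega>\<^sub>0)"
proof -
  have "\<phi> t ` \<Omega>\<^sub>0 = \<phi> (- t) -` \<Omega>\<^sub>0" by (auto simp: in_domain_iff flow_inverse)
  then show ?thesis
    using open_vimage[OF open_domain flow_continuous] by simp
qed

lemma local_extension:
  assumes "0 \<le> t" "y \<in> \<phi> t ` \<Omega>\<^sub>0"
  obtains W g where "open W" "(y, t) \<in> W" "Ck_on (Suc (Suc 0)) W g"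
    "\<And>z s. (z, s) \<in> W \<Longrightarrow> 0 \<le> s \<Longrightarrow> z \<in> closure (\<phi> s ` \<Omega>\<^sub>0) \<Longrightarrow> T z s = g (z, s)"
proof -
  have "(y, t) \<in> {(y, t). 0 \<le> t \<and> y \<in> closure (\<phi> t ` \<Omega>\<^sub>0)}"
    using assms subsetD[OF closure_subset assms(2)] by simp
  from smooth_T[unfolded smooth_on_def, rule_format, OF this] obtain W g where
    W: "open W" "(y, t) \<in> W" "\<forall>k. Ck_on k W g"
    and g: "\<forall>q\<in>W \<inter> {(y, t). 0 \<le> t \<and> y \<in> closure (\<phi> t ` \<Omega>\<^sub>0)}. g q = (case q of (y, t) \<Rightarrow> T y t)"
    by blast
  show thesis
    by (rule that[OF W(1,2) W(3)[rule_format]]) (use g in force)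
qed

text \<open>At a fixed time the moving domain is open in space, so near each of its points T agrees
  with a slice of a smooth extension, even at t = 0.\<close>

lemma T_twice_differentiable:
  assumes "0 \<le> t"
  shows "twice_differentiable_on (\<phi> t ` \<Omega>\<^sub>0) (\<lambda>z. T z t)"
proof -
  have "\<exists>N. y \<in> N \<and> twice_differentiable_on N (\<lambda>z. T z t)" if "y \<in> \<phi> t ` \<Omega>\<^sub>0" for y
  proof -
    obtain W g where W: "open W" "(y, t) \<in> W" "Ck_on (Suc (Suc 0)) W g"
      and g: "\<And>z s. (z, s) \<in> W \<Longrightarrow> 0 \<le> s \<Longrightarrow> z \<in> closure (\<phi> s ` \<Omega>\<^sub>0) \<Longrightarrow> T z s = g (z, s)"
      using local_extension[OF assms \<open>y \<in> \<phi> t ` \<Omega>\<^sub>0\<close>] by metis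
    let ?N = "{z. (z, t) \<in> W} \<inter> \<phi> t ` \<Omega>\<^sub>0"
    have "open {z. (z, t) \<in> W}"
      using open_vimage[OF W(1), of "\<lambda>z. (z, t)"] by (simp add: vimage_def continuous_on_Pair)
    then have open_N: "open ?N" by (intro open_Int open_moving_domain)
    have twice: "twice_differentiable_on ?N (\<lambda>z. g (z, t))"
      using twice_differentiable_on_slice[OF W(1,3), of t] by (simp add: twice_differentiable_on_def)
    have eq: "g (z, t) = T z t" if "z \<in> ?N" for z
      using g[of z t] that assms closure_subset[of "\<phi> t ` \<Omega>\<^sub>0"] by auto
    have "y \<in> ?N" using W(2) \<open>y \<in> \<phi> t ` \<Omega>\<^sub>0\<close> by simp
    moreover have "twice_differentiable_on ?N (\<lambda>z. T z t)"
      by (rule twice_differentiable_on_cong[OF open_N eq twice])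
    ultimately show ?thesis by (intro exI[of _ ?N] conjI)
  qed
  then show ?thesis unfolding twice_differentiable_on_def by blast
qed

lemma balance_eq_iff_heat_eq:
  assumes t: "0 \<le> t" and y: "y \<in> \<phi> t ` \<Omega>\<^sub>0"
    and J: "\<And>z. z \<in> \<phi> t ` \<Omega>\<^sub>0 \<Longrightarrow> J z t = - k *\<^sub>R grad (\<lambda>z. T z t) z"
  shows "balance_eq V J f T y t \<longleftrightarrow> heat_eq k V f T y t"
proof -
  note T2 = T_twice_differentiable[OF t]
  have "divergence (\<lambda>z. J z t) y = - k * laplacian (\<lambda>z. T z t) y"
    by (rule divergence_grad[OF open_moving_domain y T2 J])
  moreover have "divergence (\<lambda>z. T z t *\<^sub>R V z) y = grad (\<lambda>z. T z t) y \<bullet> V y + T y t * divergence V y"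
    using T2 y deriv by (intro divergence_scaleR) (auto simp: twice_differentiable_on_def differentiable_def)
  ultimately show ?thesis
    by (auto simp: balance_eq_def heat_eq_def algebra_simps)
qed

text \<open>Apply \<open>laplacian_compose\<close> to the pulled-back function and p = \<phi>(-t),
  whose components are \<open>psi\<close>. The pulled-back function is itself a composition with
  \<phi>(t), hence twice differentiable.\<close>

lemma laplacian_pullback:
  assumes t: "0 \<le> t" and x: "x \<in> \<Omega>\<^sub>0"
  shows "laplacian (\<lambda>z. T z t) (\<phi> t x) =
    (\<Sum>l\<in>UNIV. \<Sum>i\<in>UNIV. coeff_a \<phi> l i x t * partial l (partial i (\<lambda>z. pullback \<phi> T z t)) x)
    + (\<Sum>i\<in>UNIV. coeff_s \<phi> i x t * partial i (\<lambda>z. pullback \<phi> T z t) x)"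
proof -
  have psi: "psi \<phi> i t = (\<lambda>z. \<phi> (- t) z $ i)" for i
    by (simp add: psi_def inv_flow fun_eq_iff)
  have T: "(\<lambda>z. T z t) = (\<lambda>z. pullback \<phi> T (\<phi> (- t) z) t)"
    by (simp add: pullback_def flow_inverse)
  have "twice_differentiable_on \<Omega>\<^sub>0 (\<lambda>z. pullback \<phi> T z t)"
    unfolding pullback_def
    by (rule twice_differentiable_on_compose[OF open_domain T_twice_differentiable[OF t] subset_refl
          flow_differentiable flow_component_twice_differentiable[OF smooth_V flow_V]])
  then have "laplacian (\<lambda>z. pullback \<phi> T (\<phi> (- t) z) t) (\<phi> t x) =
    (\<Sum>l\<in>UNIV. \<Sum>i\<in>UNIV. coeff_a \<phi> l i x t * partial l (partial i (\<lambda>z. pullback \<phi> T z t)) (\<phi> (- t) (\<phi> t x)))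
    + (\<Sum>i\<in>UNIV. coeff_s \<phi> i x t * partial i (\<lambda>z. pullback \<phi> T z t) (\<phi> (- t) (\<phi> t x)))"
    unfolding coeff_a_def coeff_s_def psi
    by (intro laplacian_compose[where B = \<Omega>\<^sub>0 and U = "\<phi> t ` \<Omega>\<^sub>0"] open_moving_domain
        flow_differentiable flow_component_twice_differentiable[OF smooth_V flow_V])
      (use x flow_inverse in auto)
  then show ?thesis
    by (simp add: T flow_inverse)
qed

lemma pulled_balance_eq_iff_pulled_heat_eq:
  assumes t: "0 \<le> t" and x: "x \<in> \<Omega>\<^sub>0"
    and J: "\<And>z. z \<in> \<phi> t ` \<Omega>\<^sub>0 \<Longrightarrow> J z t = - k *\<^sub>R grad (\<lambda>z. T z t) z"
  shows "pulled_balance_eq \<phi> V J f T x t \<longleftrightarrow> pulled_heat_eq k \<phi> V f T x t"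
proof -
  have "divergence (\<lambda>z. J z t) (\<phi> t x) = - k * laplacian (\<lambda>z. T z t) (\<phi> t x)"
    using x by (intro divergence_grad[OF open_moving_domain _ T_twice_differentiable[OF t] J]) auto
  then have "pullback \<phi> (\<lambda>y t. divergence (\<lambda>z. J z t) y) x t =
      - k * laplacian (\<lambda>z. T z t) (\<phi> t x)"
    by (simp add: pullback_def)
  then show ?thesis
    unfolding pulled_balance_eq_def pulled_heat_eq_def laplacian_pullback[OF t x, symmetric]
    by (auto simp: algebra_simps)
qed

text \<open>All three terms are values of one derivative \<open>g'\<close> in space-time: at (V y,
  1) along the trajectory, at (0, 1) for fixed y, and at (V y, 0) for the transport term.\<close>

lemma time_deriv_pullback:
  assumes t: "0 \<le> t" and x: "x \<in> \<Omega>\<^sub>0"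
  shows "time_deriv (pullback \<phi> T) x t =
    time_deriv T (\<phi> t x) t + grad (\<lambda>z. T z t) (\<phi> t x) \<bullet> V (\<phi> t x)"
proof -
  define y where "y = \<phi> t x"
  have y: "y \<in> \<phi> t ` \<Omega>\<^sub>0" using x by (simp add: y_def)
  obtain W g where W: "open W" "(y, t) \<in> W" "Ck_on (Suc (Suc 0)) W g"
    and g: "\<And>z s. (z, s) \<in> W \<Longrightarrow> 0 \<le> s \<Longrightarrow> z \<in> closure (\<phi> s ` \<Omega>\<^sub>0) \<Longrightarrow> T z s = g (z, s)"
    using local_extension[OF t y] by metis
  have "g differentiable (at (y, t))" using W by simp
  then obtain g' where g': "(g has_derivative g') (at (y, t))"
    unfolding differentiable_def by blast
  then have lin: "linear g'" by (rule has_derivative_linear)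
  \<comment> \<open>Stated for a general curve, since it is needed both for the trajectory and for
    the constant curve at y.\<close>
  have along: "((\<lambda>s. T (c s) s) has_vector_derivative g' (c', 1)) (at t within {0..})"
    if c: "(c has_vector_derivative c') (at t)" "c t = y"
      and inside: "\<forall>\<^sub>F s in nhds t. c s \<in> \<phi> s ` \<Omega>\<^sub>0" for c c'
  proof -
    have cs: "((\<lambda>s. (c s, s)) has_derivative (\<lambda>h. (h *\<^sub>R c', h))) (at t)"
      using c(1) unfolding has_vector_derivative_def
      by (intro has_derivative_Pair has_derivative_ident) auto
    have "((\<lambda>s. g (c s, s)) has_derivative (\<lambda>h. g' (h *\<^sub>R c', h))) (at t)"
      by (rule has_derivative_compose[OF cs]) (simp add: c g')
    moreover have "g' (h *\<^sub>R c', h) = h *\<^sub>R g' (c', 1)" for h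
      using linear_cmul[OF lin, of h "(c', 1)"] by simp
    ultimately have der: "((\<lambda>s. g (c s, s)) has_vector_derivative g' (c', 1)) (at t within {0..})"
      unfolding has_vector_derivative_def by (auto intro: has_derivative_at_withinI)
    have ev: "\<forall>\<^sub>F s in nhds t. 0 \<le> s \<longrightarrow> g (c s, s) = T (c s) s"
    proof -
      have "((\<lambda>s. (c s, s)) \<longlongrightarrow> (c t, t)) (nhds t)"
        using has_derivative_continuous[OF cs] tendsto_at_iff_tendsto_nhds[of "\<lambda>s. (c s, s)" t]
        by (simp add: isCont_def)
      then have "\<forall>\<^sub>F s in nhds t. (c s, s) \<in> W"
        using W(1,2) c(2) by (auto simp: tendsto_def)
      then show ?thesis
        using inside by eventually_elim (use g closure_subset in \<open>metis subsetD\<close>)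
    qed
    show ?thesis
      unfolding has_vector_derivative_def
    proof (rule has_derivative_transform_eventually[OF der[unfolded has_vector_derivative_def]])
      show "\<forall>\<^sub>F s in at t within {0..}. g (c s, s) = T (c s) s"
        unfolding eventually_at_filter using ev by eventually_elim simp
      show "g (c t, t) = T (c t) t"
        using eventually_nhds_x_imp_x[OF ev] t by simp
    qed (use t in simp)
  qed
  have "((\<lambda>s. T (\<phi> s x) s) has_vector_derivative g' (V y, 1)) (at t within {0..})"
    using flow[of x t] x by (intro along) (auto simp: y_def)
  then have moving: "time_deriv (pullback \<phi> T) x t = g' (V y, 1)"
    unfolding time_deriv_def pullback_def by (rule vector_derivative_at_within_atLeast[OF t])
  \<comment> \<open>A fixed point of the moving domain stays in it for nearby times, because its
    preimage moves continuously in an open set.\<close>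
  have "\<forall>\<^sub>F s in nhds t. y \<in> \<phi> s ` \<Omega>\<^sub>0"
  proof -
    have "open ((\<lambda>s. \<phi> (- s) y) -` \<Omega>\<^sub>0)"
    proof (rule open_vimage[OF open_domain])
      have "continuous_on UNIV (\<lambda>s. \<phi> s y)"
        by (intro continuous_at_imp_continuous_on ballI has_vector_derivative_continuous[OF flow])
      from continuous_on_compose2[OF this, of UNIV uminus]
      show "continuous_on UNIV (\<lambda>s. \<phi> (- s) y)" by (simp add: continuous_on_minus)
    qed
    then have "\<forall>\<^sub>F s in nhds t. s \<in> (\<lambda>s. \<phi> (- s) y) -` \<Omega>\<^sub>0"
      by (rule eventually_nhds_in_open) (use y in \<open>simp add: in_domain_iff\<close>)
    then show ?thesis by (simp add: in_domain_iff)
  qed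
  then have "((\<lambda>s. T y s) has_vector_derivative g' (0, 1)) (at t within {0..})"
    by (intro along) auto
  then have fixed: "time_deriv T y t = g' (0, 1)"
    unfolding time_deriv_def by (rule vector_derivative_at_within_atLeast[OF t])
  have "((\<lambda>z. T z t) has_derivative (\<lambda>h. g' (h, 0))) (at y)"
  proof (rule has_derivative_transform_within_open)
    show "((\<lambda>z. g (z, t)) has_derivative (\<lambda>h. g' (h, 0))) (at y)"
      by (rule has_derivative_compose[where f = "\<lambda>z. (z, t)"])
        (auto intro!: has_derivative_Pair has_derivative_ident has_derivative_const g')
    have "open {z. (z, t) \<in> W}"
      using open_vimage[OF W(1), of "\<lambda>z. (z, t)"] by (simp add: vimage_def continuous_on_Pair)
    then show "open ({z. (z, t) \<in> W} \<inter> \<phi> t ` \<Omega>\<^sub>0)" by (intro open_Int open_moving_domain)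
    show "g (z, t) = T z t" if "z \<in> {z. (z, t) \<in> W} \<inter> \<phi> t ` \<Omega>\<^sub>0" for z
      using g[of z t] that t closure_subset[of "\<phi> t ` \<Omega>\<^sub>0"] by auto
  qed (use W y in auto)
  from derivative_eq_grad[OF this, of "V y"]
  have "grad (\<lambda>z. T z t) y \<bullet> V y = g' (V y, 0)" by simp
  then show ?thesis
    using moving fixed linear_add[OF lin, of "(0, 1)" "(V y, 0)"] by (simp add: y_def)
qed

text \<open>The product rule splits off the transport term from the divergence of T V, and this is
  exactly the term that \<open>time_deriv_pullback\<close> absorbs into the time derivative.\<close>

lemma balance_eq_iff_pulled_balance_eq:
  assumes t: "0 \<le> t" and x: "x \<in> \<Omega>\<^sub>0"
  shows "balance_eq V J f T (\<phi> t x) t \<longleftrightarrow> pulled_balance_eq \<phi> V J f T x t"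
proof -
  have "divergence (\<lambda>z. T z t *\<^sub>R V z) (\<phi> t x) =
      grad (\<lambda>z. T z t) (\<phi> t x) \<bullet> V (\<phi> t x) + T (\<phi> t x) t * divergence V (\<phi> t x)"
    using T_twice_differentiable[OF t] x deriv
    by (intro divergence_scaleR) (auto simp: twice_differentiable_on_def differentiable_def)
  then show ?thesis
    unfolding balance_eq_def pulled_balance_eq_def time_deriv_pullback[OF t x]
    by (simp add: pullback_def algebra_simps)
qed

text \<open>Boundary values transfer because \<phi>(t) is a homeomorphism of the whole space and so
  maps frontier to frontier; initial values because \<phi>(0) is the identity.\<close>

lemma ibvp_pullback:
  assumes "\<And>t x. 0 \<le> t \<Longrightarrow> x \<in> \<Omega>\<^sub>0 \<Longrightarrow> eqn (\<phi> t x) t \<longleftrightarrow> eqn' x t"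
  shows "ibvp (\<lambda>t. \<phi> t ` \<Omega>\<^sub>0) \<Omega>\<^sub>0 eqn T T\<^sub>0 \<longleftrightarrow> ibvp (\<lambda>t. \<Omega>\<^sub>0) \<Omega>\<^sub>0 eqn' (pullback \<phi> T) T\<^sub>0"
  unfolding ibvp_def homeomorphism_frontier_image[OF homeomorphism_flow]
  using assms by (simp add: pullback_def init)

end

theorem proposition6p1:
  fixes \<Omega>\<^sub>0 :: "(real^'n) set"
    and V :: "real^'n \<Rightarrow> real^'n"
    and \<phi> :: "real \<Rightarrow> real^'n \<Rightarrow> real^'n"
    and \<Omega> :: "real \<Rightarrow> (real^'n) set"
    and k :: real
    and f T :: "real^'n \<Rightarrow> real \<Rightarrow> real"
    and T\<^sub>0 :: "real^'n \<Rightarrow> real"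
    and J :: "real^'n \<Rightarrow> real \<Rightarrow> real^'n"
  assumes "smooth_open_set \<Omega>\<^sub>0"
    and "smooth_on UNIV V"
    and "flow_of V \<phi>"
    and "\<And>t. \<Omega> t = moving_domain \<phi> \<Omega>\<^sub>0 t"
    and "k > 0"
    and "smooth_on {(y, t). 0 \<le> t \<and> y \<in> \<Omega> t} (\<lambda>(y, t). f y t)"
    and "smooth_on {(y, t). 0 \<le> t \<and> y \<in> closure (\<Omega> t)} (\<lambda>(y, t). T y t)"
    and "\<And>t y. 0 \<le> t \<Longrightarrow> y \<in> \<Omega> t \<Longrightarrow> J y t = - k *\<^sub>R grad (\<lambda>z. T z t) y"
  shows "(\<forall>t\<ge>0. \<forall>y\<in>\<Omega> t. balance_eq V J f T y t \<longleftrightarrow> heat_eq k V f T y t) \<and>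
         (\<forall>t\<ge>0. \<forall>x\<in>\<Omega>\<^sub>0. pulled_balance_eq \<phi> V J f T x t \<longleftrightarrow> pulled_heat_eq k \<phi> V f T x t) \<and>
         (ibvp \<Omega> \<Omega>\<^sub>0 (balance_eq V J f T) T T\<^sub>0 \<longleftrightarrow>
         ibvp (\<lambda>t. \<Omega>\<^sub>0) \<Omega>\<^sub>0 (pulled_balance_eq \<phi> V J f T) (pullback \<phi> T) T\<^sub>0) \<and>
         (ibvp \<Omega> \<Omega>\<^sub>0 (balance_eq V J f T) T T\<^sub>0 \<longleftrightarrow> ibvp \<Omega> \<Omega>\<^sub>0 (heat_eq k V f T) T T\<^sub>0) \<and>
         (ibvp (\<lambda>t. \<Omega>\<^sub>0) \<Omega>\<^sub>0 (pulled_balance_eq \<phi> V J f T) (pullback \<phi> T) T\<^sub>0 \<longleftrightarrow>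
         ibvp (\<lambda>t. \<Omega>\<^sub>0) \<Omega>\<^sub>0 (pulled_heat_eq k \<phi> V f T) (pullback \<phi> T) T\<^sub>0) \<and>
         (\<forall>t\<ge>0. \<forall>x\<in>\<Omega>\<^sub>0. \<forall>l i.
         coeff_a \<phi> l i x t = grad (psi \<phi> l t) (\<phi> t x) \<bullet> grad (psi \<phi> i t) (\<phi> t x) \<and>
         coeff_s \<phi> i x t = laplacian (psi \<phi> i t) (\<phi> t x))"
proof -
  have \<Omega>: "\<Omega> = (\<lambda>t. \<phi> t ` \<Omega>\<^sub>0)"
    using assms(4) by (simp add: fun_eq_iff moving_domain_def)
  interpret moving_domain_problem \<Omega>\<^sub>0 V \<phi> T
    using assms(1,2,3,7) by unfold_locales (simp_all add: smooth_open_set_def \<Omega>)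
  have heat: "balance_eq V J f T y t \<longleftrightarrow> heat_eq k V f T y t" if "0 \<le> t" "y \<in> \<Omega> t" for t y
    using that assms(8) by (intro balance_eq_iff_heat_eq) (auto simp: \<Omega>)
  have pulled: "pulled_balance_eq \<phi> V J f T x t \<longleftrightarrow> pulled_heat_eq k \<phi> V f T x t"
    if "0 \<le> t" "x \<in> \<Omega>\<^sub>0" for t x
    using that assms(8) by (intro pulled_balance_eq_iff_pulled_heat_eq) (auto simp: \<Omega>)
  have "ibvp \<Omega> \<Omega>\<^sub>0 (balance_eq V J f T) T T\<^sub>0 \<longleftrightarrow>
      ibvp (\<lambda>t. \<Omega>\<^sub>0) \<Omega>\<^sub>0 (pulled_balance_eq \<phi> V J f T) (pullback \<phi> T) T\<^sub>0"
    unfolding \<Omega> by (intro ibvp_pullback balance_eq_iff_pulled_balance_eq)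
  moreover have "coeff_a \<phi> l i x t = grad (psi \<phi> l t) (\<phi> t x) \<bullet> grad (psi \<phi> i t) (\<phi> t x)"
    and "coeff_s \<phi> i x t = laplacian (psi \<phi> i t) (\<phi> t x)" for l i x t
    by (simp_all add: coeff_a_def coeff_s_def grad_def inner_vec_def laplacian_def)
  moreover have "ibvp \<Omega> \<Omega>\<^sub>0 (balance_eq V J f T) T T\<^sub>0 \<longleftrightarrow> ibvp \<Omega> \<Omega>\<^sub>0 (heat_eq k V f T) T T\<^sub>0"
    unfolding ibvp_def using heat by simp
  moreover have "ibvp (\<lambda>t. \<Omega>\<^sub>0) \<Omega>\<^sub>0 (pulled_balance_eq \<phi> V J f T) (pullback \<phi> T) T\<^sub>0 \<longleftrightarrow>
      ibvp (\<lambda>t. \<Omega>\<^sub>0) \<Omega>\<^sub>0 (pulled_heat_eq k \<phi> V f T) (pullback \<phi> T) T\<^sub>0"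
    unfolding ibvp_def using pulled by simp
  ultimately show ?thesis
    using heat pulled by blast
qed

end
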